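(* Let $d\ge 1$ be an integer and $0<\alpha<2$. Assume: (a) $\varphi:\mathbb{R}\to[0,\infty)$ is a convex differentiable function with $\varphi(0)=0$ and $\varphi(x)>0$ if $x\neq 0$; (b) $h:[0,\infty)\to[0,\infty)$ is a continuous function with $h(x)>0$ if $x\neq 0$; (c) $k:[0,\infty)\to[0,\infty)$ is a continuous function; (d) $\sup_{t\in[0,T]}\int_0^t\left(\int_s^t k(r)\,dr\right)^{-1/\alpha}ds<\infty$ for every $T>0$; (e) $u_0,v_0\in C_b(\mathbb{R}^d)\cap L^1(\mathbb{R}^d)$. Let $u$ and $v$ be the solutions in $C_b^{1,2}((0,\infty)\times\mathbb{R}^d)$ of $$\partial_t u=k(t)\Delta_\alpha u(t)-h(t)\varphi(u(t)),\quad u(0)=u_0,$$ and $$\partial_t v=k(t)\Delta_\alpha v(t)-h(t)\varphi(v(t)),\quad v(0)=v_0,$$ respectively, on $(0,\infty)\times\mathbb{R}^d$. If $v_0\ge u_0\ge 0$, then $v\ge u\ge 0$.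
   Context: $C_b(\mathbb{R}^d)$ is the space of bounded continuous real functions on $\mathbb{R}^d$; $C_b^2(\mathbb{R}^d)$ is the space of $C^2$ functions that are bounded together with their derivatives up to order two. $\Delta_\alpha=-(-\Delta)^{\alpha/2}$ is the fractional Laplacian (Fourier symbol $-\|\xi\|^\alpha$), defined on $C_b^2(\mathbb{R}^d)$ by $$\Delta_\alpha f(x)=c\left(\int_{\|z\|<r}\frac{f(x+z)-f(x)-\nabla f(x)\cdot z}{\|z\|^{d+\alpha}}dz+\int_{\|z\|\ge r}\frac{f(x+z)-f(x)}{\|z\|^{d+\alpha}}dz\right),$$ where $c=c(\alpha,d)>0$ is the normalizing constant giving the symbol $-\|\xi\|^\alpha$, and the value does not depend on $r>0$. In the equations $\Delta_\alpha$ acts in the $x$ variable. A solution $u\in C_b^{1,2}((0,\infty)\times\mathbb{R}^d)$ is a classical one: $u$ is bounded, continuous on $[0,\infty)\times\mathbb{R}^d$ with $u(0,\cdot)=u_0$, continuously differentiable in $t$ on $(0,\infty)\times\mathbb{R}^d$, $u(t,\cdot)\in C_b^2(\mathbb{R}^d)$ for each $t>0$, and the equation holds pointwise for $t>0$ (similarly for $v$ with $v_0$). *)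

theory Defs
  imports "HOL-Analysis.Analysis"
begin

text \<open>
  \<open>Cb2\<close> is the space of twice continuously (Frechet) differentiable real functions that are
  bounded together with their first and second derivative; derivatives are measured in operator norm.
\<close>
definition Cb2 :: "('a::euclidean_space \<Rightarrow> real) set" where
  "Cb2 = {f. bounded (range f) \<and>
     (\<exists>f' :: 'a \<Rightarrow> 'a \<Rightarrow>\<^sub>L real. \<exists>f'' :: 'a \<Rightarrow> 'a \<Rightarrow>\<^sub>L ('a \<Rightarrow>\<^sub>L real).
        (\<forall>x. (f has_derivative blinfun_apply (f' x)) (at x)) \<and>
        (\<forall>x. (f' has_derivative blinfun_apply (f'' x)) (at x)) \<and>
        continuous_on UNIV f'' \<and> bounded (range f') \<and> bounded (range f''))}"

text \<open>
  The singular integral defining the fractional Laplacian, without its normalizing constant and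
  with truncation radius \<open>r\<close>. The integrands are totalized by the value \<open>0\<close> at \<open>z = 0\<close>.
\<close>
definition frac_laplace_kernel :: "real \<Rightarrow> real \<Rightarrow> ('a::euclidean_space \<Rightarrow> real) \<Rightarrow> 'a \<Rightarrow> real" where
  "frac_laplace_kernel \<alpha> r f x =
     (LINT z : {z. norm z < r} | lborel.
        (f (x + z) - f x - frechet_derivative f (at x) z) / norm z powr (real DIM('a) + \<alpha>)) +
     (LINT z : {z. r \<le> norm z} | lborel.
        (f (x + z) - f x) / norm z powr (real DIM('a) + \<alpha>))"

text \<open>
  The normalizing constant is the \<open>c > 0\<close> for which the operator has Fourier symbol
  \<open>- norm \<xi> powr \<alpha>\<close>. In real form this says that every plane wave \<open>y \<mapsto> cos (\<xi> \<bullet> y)\<close> is an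
  eigenfunction with that eigenvalue; the waves \<open>sin (\<xi> \<bullet> y)\<close> are translates of these.
\<close>
definition frac_laplace_const :: "'a::euclidean_space itself \<Rightarrow> real \<Rightarrow> real" where
  "frac_laplace_const _ \<alpha> = (THE c. 0 < c \<and>
     (\<forall>\<xi> x :: 'a. c * frac_laplace_kernel \<alpha> 1 (\<lambda>y. cos (\<xi> \<bullet> y)) x
                    = - (norm \<xi> powr \<alpha>) * cos (\<xi> \<bullet> x)))"

text \<open>
  For \<open>0 < \<alpha> < 2\<close> and \<open>f \<in> Cb2\<close> the kernel integral does not depend on the radius \<open>r > 0\<close>,
  since \<open>\<nabla>f(x) \<cdot> z / norm z powr (d + \<alpha>)\<close> is odd in \<open>z\<close>; the radius is fixed to \<open>1\<close>.
\<close>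
definition frac_laplace :: "real \<Rightarrow> ('a::euclidean_space \<Rightarrow> real) \<Rightarrow> 'a \<Rightarrow> real" where
  "frac_laplace \<alpha> f x = frac_laplace_const TYPE('a) \<alpha> * frac_laplace_kernel \<alpha> 1 f x"

text \<open>
  Classical solutions of \<open>\<partial>\<^sub>t u = k(t) \<Delta>\<^sub>\<alpha> u - h(t) \<phi>(u)\<close>, \<open>u(0) = u0\<close>. The first argument of
  \<open>u\<close> is time; only its values for \<open>t \<ge> 0\<close> matter.
\<close>
definition classical_solution ::
  "real \<Rightarrow> (real \<Rightarrow> real) \<Rightarrow> (real \<Rightarrow> real) \<Rightarrow> (real \<Rightarrow> real) \<Rightarrow>
   ('a::euclidean_space \<Rightarrow> real) \<Rightarrow> (real \<Rightarrow> 'a \<Rightarrow> real) \<Rightarrow> bool" where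
  "classical_solution \<alpha> k h \<phi> u0 u \<longleftrightarrow>
     bounded ((\<lambda>(t, x). u t x) ` ({0..} \<times> UNIV)) \<and>
     continuous_on ({0..} \<times> UNIV) (\<lambda>(t, x). u t x) \<and>
     (\<forall>x. u 0 x = u0 x) \<and>
     (\<forall>t>0. \<forall>x. (\<lambda>s. u s x) differentiable (at t)) \<and>
     continuous_on ({0<..} \<times> UNIV) (\<lambda>(t, x). deriv (\<lambda>s. u s x) t) \<and>
     (\<forall>t>0. u t \<in> Cb2) \<and>
     (\<forall>t>0. \<forall>x. deriv (\<lambda>s. u s x) t = k t * frac_laplace \<alpha> (u t) x - h t * \<phi> (u t x))"

end

(* The difference v - u is compared with zero by the maximum principle. Since v - u is only bounded
   in space, a minimum need not be attained; a multiple of the barrier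
   1 - 1 / (1 + |s x|^2) is therefore added to exp (- \<Lambda> t) (v - u). It forces a minimum, where the
   nonlocal operator is nonnegative, and its own fractional Laplacian is O(s^2 + s^(\<alpha>/2)) uniformly
   in x, so the error vanishes as s tends to 0. The sign of the normalizing constant has to be known:
   it comes from the radial homogeneous symbol \<integral> (1 - cos (\<xi> \<bullet> z)) / |z|^(d+\<alpha>) dz of the kernel.
   Nonnegativity of u is the comparison with the solution 0. *)
theory Submission
  imports Defs
begin

section \<open>Invariance of Lebesgue measure and integrability of power kernels\<close>

text \<open>The normalizing constant is a definite description, so nothing is known about it before
  existence and uniqueness are proved. For this the symbol of the kernel must be an exact multiple
  of \<open>norm \<xi> powr \<alpha>\<close>, and that is where scaling and rotation invariance of
  Lebesgue measure enter. The barrier has to be bounded because the operator integrates over all of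
  space: a quadratically growing function would have a divergent tail for \<alpha> < 2. It is
  instead controlled by a Lipschitz constant \<open>L\<close> of \<phi> on a range containing the
  values of both solutions. With \<open>H\<close> a bound of \<open>h\<close> up to the final time,
  the weight with rate \<open>H * L + 1\<close> absorbs the reaction term, and the extra 1 leaves a
  strictly positive margin at a negative minimum, against which the barrier error is
  weighed.\<close>

lemma lborel_distr_affine:
  fixes t :: "'a::euclidean_space"
  assumes "\<bar>c\<bar> = 1"
  shows "distr lborel borel (\<lambda>x. t + c *\<^sub>R x) = lborel"
proof -
  have "c \<noteq> 0" using assms by auto
  from lborel_affine[OF this, of t] show ?thesis
    using assms by (simp add: density_1)
qed

text \<open>Orthogonal maps are treated with two instances: translation (\<open>c = 1\<close>) and
  reflection (\<open>c = -1\<close>).\<close>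

lemma nn_integral_lborel_affine:
  fixes t :: "'a::euclidean_space"
  assumes "\<bar>c\<bar> = 1" and [measurable]: "g \<in> borel_measurable borel"
  shows "(\<integral>\<^sup>+x. g (t + c *\<^sub>R x) \<partial>lborel) = (\<integral>\<^sup>+x. g x \<partial>lborel)"
proof -
  have "(\<integral>\<^sup>+x. g x \<partial>lborel) = (\<integral>\<^sup>+x. g x \<partial>distr lborel borel (\<lambda>x. t + c *\<^sub>R x))"
    by (simp add: lborel_distr_affine[OF assms(1)])
  also have "\<dots> = (\<integral>\<^sup>+x. g (t + c *\<^sub>R x) \<partial>lborel)"
    by (rule nn_integral_distr) simp_all
  finally show ?thesis by simp
qed

lemma integral_lborel_scaleR:
  fixes g :: "'a::euclidean_space \<Rightarrow> real"
  assumes "c \<noteq> 0" and [measurable]: "g \<in> borel_measurable borel"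
  shows "(LINT x|lborel. g x) = \<bar>c\<bar> ^ DIM('a) * (LINT x|lborel. g (c *\<^sub>R x))"
proof -
  have "(LINT x|lborel. g x) = (LINT x|density (distr lborel borel (\<lambda>x. 0 + c *\<^sub>R x)) (\<lambda>_. \<bar>c\<bar>^DIM('a)). g x)"
    by (subst lborel_affine[OF assms(1), of 0]) (rule refl)
  also have "\<dots> = (LINT x|distr lborel borel (\<lambda>x. 0 + c *\<^sub>R x). \<bar>c\<bar>^DIM('a) *\<^sub>R g x)"
    by (subst integral_density) auto
  also have "\<dots> = (LINT x|lborel. \<bar>c\<bar>^DIM('a) *\<^sub>R g (0 + c *\<^sub>R x))"
    by (subst integral_distr) auto
  finally show ?thesis by simp
qed

text \<open>The measure transported by \<open>f\<close> is translation invariant, so by Fubini it is a multiple of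
  Lebesgue measure; the factor is \<open>1\<close> because \<open>f\<close> preserves the unit ball.\<close>

lemma lborel_distr_orthogonal:
  fixes f :: "'a::euclidean_space \<Rightarrow> 'a"
  assumes f: "orthogonal_transformation f"
  shows "distr lborel borel f = lborel"
proof -
  have lin: "linear f" using f by (rule orthogonal_transformation_linear)
  have cont: "continuous_on UNIV f" using lin by (simp add: linear_continuous_on linear_linear)
  have [measurable]: "f \<in> borel_measurable borel"
    using cont by (rule borel_measurable_continuous_onI)
  obtain g where g: "\<And>y. f (g y) = y"
    using orthogonal_transformation_surj[OF f] by (metis surjD)
  define B where "B = ball (0::'a) 1"
  have [measurable]: "B \<in> sets borel" by (simp add: B_def)
  have fB: "f x \<in> B \<longleftrightarrow> x \<in> B" for x
    using orthogonal_transformation_norm[OF f] by (simp add: B_def)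
  show ?thesis
  proof (rule measure_eqI)
    fix A assume "A \<in> sets (distr lborel borel f)"
    then have [measurable]: "A \<in> sets borel" by simp
    let ?a = "indicator A :: 'a \<Rightarrow> ennreal" and ?b = "indicator B :: 'a \<Rightarrow> ennreal"
    have "emeasure (distr lborel borel f) A = (\<integral>\<^sup>+x. ?a x \<partial>distr lborel borel f)"
      by simp
    also have "\<dots> = (\<integral>\<^sup>+x. ?a (f x) \<partial>lborel)"
      by (rule nn_integral_distr) simp_all
    finally have *: "emeasure (distr lborel borel f) A = (\<integral>\<^sup>+x. ?a (f x) \<partial>lborel)" .
    have "emeasure (distr lborel borel f) A * emeasure lborel B
        = (\<integral>\<^sup>+x. ?a (f x) * (\<integral>\<^sup>+y. ?b y \<partial>lborel) \<partial>lborel)"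
      unfolding * by (simp add: nn_integral_multc)
    also have "\<dots> = (\<integral>\<^sup>+x. ?a (f x) * (\<integral>\<^sup>+y. ?b (f x + 1 *\<^sub>R y) \<partial>lborel) \<partial>lborel)"
      by (simp only: nn_integral_lborel_affine[where g="?b"] abs_one borel_measurable_indicator \<open>B \<in> sets borel\<close>)
    also have "\<dots> = (\<integral>\<^sup>+x. (\<integral>\<^sup>+y. ?a (f x) * ?b (f x + y) \<partial>lborel) \<partial>lborel)"
      unfolding scaleR_one by (intro nn_integral_cong nn_integral_cmult[symmetric]) measurable
    also have "\<dots> = (\<integral>\<^sup>+y. (\<integral>\<^sup>+x. ?a (f x) * ?b (f x + y) \<partial>lborel) \<partial>lborel)"
      by (rule lborel_pair.Fubini') measurable
    \<comment> \<open>Since \<open>g y\<close> is a preimage of \<open>y\<close>, translating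
      \<open>x\<close> by \<open>- g y\<close> turns \<open>f x\<close> into \<open>f x - y\<close>.
      The shift thereby moves from the indicator of \<open>B\<close> to that of \<open>A\<close>,
      and the reflected integral over \<open>y\<close> then no longer sees \<open>f\<close>.\<close>
    also have "\<dots> = (\<integral>\<^sup>+y. (\<integral>\<^sup>+x. ?a (f (- g y + 1 *\<^sub>R x)) * ?b (f (- g y + 1 *\<^sub>R x) + y) \<partial>lborel) \<partial>lborel)"
      by (intro nn_integral_cong nn_integral_lborel_affine[where g="\<lambda>x. ?a (f x) * ?b (f x + _)", symmetric]) simp_all
    also have "\<dots> = (\<integral>\<^sup>+y. (\<integral>\<^sup>+x. ?a (f x - y) * ?b (f x) \<partial>lborel) \<partial>lborel)"
      by (simp add: linear_diff[OF lin] linear_add[OF lin] linear_neg[OF lin] g)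
    also have "\<dots> = (\<integral>\<^sup>+x. (\<integral>\<^sup>+y. ?a (f x - y) * ?b (f x) \<partial>lborel) \<partial>lborel)"
      by (rule lborel_pair.Fubini') measurable
    also have "\<dots> = (\<integral>\<^sup>+x. (\<integral>\<^sup>+y. ?a (f x + (-1) *\<^sub>R y) \<partial>lborel) * ?b (f x) \<partial>lborel)"
      by (simp add: nn_integral_multc)
    also have "\<dots> = (\<integral>\<^sup>+x. emeasure lborel A * ?b x \<partial>lborel)"
      by (subst nn_integral_lborel_affine[where g="?a"]) (simp_all add: indicator_def fB)
    also have "\<dots> = emeasure lborel A * emeasure lborel B"
      by (simp add: nn_integral_cmult)
    finally have "emeasure lborel B * emeasure (distr lborel borel f) A = emeasure lborel B * emeasure lborel A"
      by (simp add: mult.commute)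
    moreover have "emeasure lborel B \<noteq> \<infinity>" "emeasure lborel B \<noteq> 0"
      by (simp_all add: B_def emeasure_ball less_imp_neq[OF unit_ball_vol_pos, symmetric])
    ultimately show "emeasure (distr lborel borel f) A = emeasure lborel A"
      by (simp add: ennreal_mult_cancel_left)
  qed simp
qed

text \<open>The function is dominated by the sum of the multiples \<open>a n\<close> of the
  indicators of the balls of radius \<open>r n\<close>. Their integrals are at most a constant times
  \<open>q ^ n\<close>, so a geometric series takes the place of integration in polar
  coordinates.\<close>

lemma integrable_dyadic_bound:
  fixes g :: "'a::euclidean_space \<Rightarrow> real"
  assumes q: "0 \<le> q" "q < 1" and r: "\<And>n. 0 \<le> r n" and C: "\<And>n. 0 \<le> a n" "\<And>n. a n * r n ^ DIM('a) \<le> C * q ^ n"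
    and g: "g \<in> borel_measurable borel"
    and le: "\<And>z. g z \<noteq> 0 \<Longrightarrow> \<exists>n. norm z < r n \<and> \<bar>g z\<bar> \<le> a n"
  shows "integrable lborel g"
proof (rule integrableI_bounded)
  let ?v = "unit_ball_vol (real DIM('a))"
  have "0 \<le> C" using C(2)[of 0] C(1)[of 0] r[of 0] by (simp) (meson order_trans mult_nonneg_nonneg zero_le_power)
  have "(\<integral>\<^sup>+z. ennreal (norm (g z)) \<partial>lborel)
     \<le> (\<integral>\<^sup>+(z::'a). (\<Sum>n. ennreal (a n) * indicator (ball 0 (r n)) z) \<partial>lborel)"
  proof (rule nn_integral_mono)
    fix z :: 'a assume "z \<in> space lborel"
    show "ennreal (norm (g z)) \<le> (\<Sum>n. ennreal (a n) * indicator (ball 0 (r n)) z)"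
    proof (cases "g z = 0")
      case False
      with le obtain n where n: "norm z < r n" "\<bar>g z\<bar> \<le> a n" by blast
      have "ennreal (norm (g z)) \<le> (\<Sum>i\<in>{n}. ennreal (a i) * indicator (ball 0 (r i)) z)"
        using n by (simp add: ennreal_leI)
      also have "\<dots> \<le> (\<Sum>n. ennreal (a n) * indicator (ball 0 (r n)) z)"
        by (rule sum_le_suminf) auto
      finally show ?thesis .
    qed simp
  qed
  also have "\<dots> = (\<Sum>n. \<integral>\<^sup>+(z::'a). ennreal (a n) * indicator (ball 0 (r n)) z \<partial>lborel)"
    by (rule nn_integral_suminf) (intro borel_measurable_times_ennreal borel_measurable_const borel_measurable_indicator, simp)
  also have "\<dots> = (\<Sum>n. ennreal (a n * (?v * r n ^ DIM('a))))"
    by (intro suminf_cong) (simp add: nn_integral_cmult_indicator emeasure_ball r C ennreal_mult)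
  also have "\<dots> \<le> (\<Sum>n. ennreal (?v * C * q ^ n))"
  proof (intro suminf_le summableI ennreal_leI)
    fix n show "a n * (?v * r n ^ DIM('a)) \<le> ?v * C * q ^ n"
      using mult_left_mono[OF C(2)[of n], of ?v] by (simp add: mult_ac)
  qed
  also have "\<dots> < \<infinity>"
    using q \<open>0 \<le> C\<close> by (subst suminf_ennreal2) (auto intro!: summable_mult summable_geometric mult_nonneg_nonneg)
  finally show "(\<integral>\<^sup>+z. ennreal (norm (g z)) \<partial>lborel) < \<infinity>" .
qed (use g in simp)

lemma powr_power_swap: "0 < (x::real) \<Longrightarrow> (x ^ n) powr b = (x powr b) ^ n"
  by (simp add: powr_powr powr_realpow[symmetric] mult.commute)

text \<open>On the shell between the radii \<open>2 ^ n\<close> and \<open>2 ^ Suc n\<close> the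
  integrand is largest at the inner radius, while the volume grows like \<open>2 ^ n\<close> to the
  power of the dimension. What remains is geometric with ratio
  \<open>(1/2) powr \<beta>\<close>.\<close>

lemma integrable_norm_powr_outside:
  fixes \<beta> :: real
  assumes "0 < \<beta>"
  shows "integrable lborel (\<lambda>z::'a::euclidean_space. indicator {z. 1 \<le> norm z} z * (1 / norm z powr (real DIM('a) + \<beta>)))"
proof (rule integrable_dyadic_bound)
  let ?d = "DIM('a)"
  let ?q = "(1/2) powr \<beta> :: real"
  show "0 \<le> ?q" "?q < 1" using assms by (simp_all add: powr01_less_one)
  fix n :: nat
  show "0 \<le> (2::real) ^ Suc n" "0 \<le> 1 / ((2::real) ^ n) powr (real ?d + \<beta>)" by simp_all
  have "1 / ((2::real) ^ n) powr (real ?d + \<beta>) * (2 ^ Suc n) ^ ?d = 2 ^ ?d * (1 / (2 ^ n) powr \<beta>)"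
    by (simp add: powr_add powr_realpow power_mult_distrib)
  also have "\<dots> = 2 ^ ?d * ?q ^ n"
    by (simp add: powr_power_swap powr_divide power_divide)
  finally show "1 / ((2::real) ^ n) powr (real ?d + \<beta>) * (2 ^ Suc n) ^ ?d \<le> 2 ^ ?d * ?q ^ n" by simp
next
  fix z :: 'a
  assume "indicator {z. 1 \<le> norm z} z * (1 / norm z powr (real DIM('a) + \<beta>)) \<noteq> 0"
  then have z: "1 \<le> norm z" by (auto simp: indicator_def split: if_splits)
  define n where "n = (LEAST n. norm z < 2 ^ Suc n)"
  have ex: "\<exists>n. norm z < 2 ^ Suc n"
    using real_arch_pow[of 2 "norm z"] by (metis Suc_n_not_le_n less_trans linorder_not_le one_less_numeral_iff power_strict_increasing_iff semiring_norm(76) lessI)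
  have n1: "norm z < 2 ^ Suc n" unfolding n_def using ex by (rule LeastI_ex)
  have n2: "2 ^ n \<le> norm z"
  proof (cases n)
    case (Suc m)
    then have "\<not> norm z < 2 ^ Suc m" using not_less_Least[of m "\<lambda>n. norm z < 2 ^ Suc n"] n_def by auto
    then show ?thesis using Suc by simp
  qed (use z in simp)
  show "\<exists>n. norm z < 2 ^ Suc n \<and>
      \<bar>indicator {z. 1 \<le> norm z} z * (1 / norm z powr (real DIM('a) + \<beta>))\<bar> \<le> 1 / (2 ^ n) powr (real DIM('a) + \<beta>)"
    using n1 n2 z assms by (intro exI[of _ n]) (auto intro!: divide_left_mono powr_mono2 mult_pos_pos)
qed measurable

text \<open>The same argument with shells shrinking to the origin: numerator at the outer radius,
  denominator at the inner one. The ratio \<open>(1/2) powr (2 - \<alpha>)\<close> is below 1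
  because \<alpha> < 2.\<close>

lemma integrable_norm_powr_inside:
  fixes \<alpha> :: real
  assumes "0 < \<alpha>" "\<alpha> < 2"
  shows "integrable lborel (\<lambda>z::'a::euclidean_space. indicator {z. norm z < 1} z * ((norm z)\<^sup>2 / norm z powr (real DIM('a) + \<alpha>)))"
proof (rule integrable_dyadic_bound)
  let ?d = "DIM('a)"
  let ?q = "(1/2) powr (2 - \<alpha>) :: real"
  show "0 \<le> ?q" "?q < 1" using assms by (simp_all add: powr01_less_one)
  fix n :: nat
  show "0 \<le> ((1/2)::real) ^ n" "0 \<le> ((1/2) ^ n)\<^sup>2 / (((1/2)::real) ^ Suc n) powr (real ?d + \<alpha>)" by simp_all
  have "((1/2) ^ n)\<^sup>2 / (((1/2)::real) ^ Suc n) powr (real ?d + \<alpha>) * ((1/2) ^ n) ^ ?d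
      = 2 powr (real ?d + \<alpha>) * (((1/2) ^ n) powr (2 + real ?d) / ((1/2) ^ n) powr (real ?d + \<alpha>))"
    by (simp add: powr_mult powr_divide powr_add powr_realpow)
  also have "\<dots> = 2 powr (real ?d + \<alpha>) * ?q ^ n"
    by (simp add: powr_diff[symmetric] powr_power_swap[symmetric] algebra_simps)
  finally show "((1/2) ^ n)\<^sup>2 / (((1/2)::real) ^ Suc n) powr (real ?d + \<alpha>) * ((1/2) ^ n) ^ ?d \<le> 2 powr (real ?d + \<alpha>) * ?q ^ n" by simp
next
  fix z :: 'a
  assume "indicator {z. norm z < 1} z * ((norm z)\<^sup>2 / norm z powr (real DIM('a) + \<alpha>)) \<noteq> 0"
  \<comment> \<open>The origin lies in no shell; it drops out because the totalized integrand
    vanishes there.\<close>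
  then have z: "norm z < 1" "0 < norm z" by (auto simp: indicator_def split: if_splits)
  define n where "n = (LEAST n. (1/2) ^ Suc n \<le> norm z)"
  obtain m where m: "(1/2) ^ m < norm z"
    using real_arch_pow_inv[of "norm z" "1/2"] z by auto
  have ex: "\<exists>n. (1/2) ^ Suc n \<le> norm z"
    using m by (intro exI[of _ m]) (simp, smt (verit) power_one_over zero_less_power divide_pos_pos)
  have n1: "(1/2) ^ Suc n \<le> norm z" unfolding n_def using ex by (rule LeastI_ex)
  have n2: "norm z < (1/2) ^ n"
  proof (cases n)
    case (Suc m)
    then have "\<not> (1/2) ^ Suc m \<le> norm z" using not_less_Least[of m "\<lambda>n. (1/2) ^ Suc n \<le> norm z"] n_def by auto
    then show ?thesis using Suc by simp
  qed (use z in simp)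
  have "(norm z)\<^sup>2 / norm z powr (real DIM('a) + \<alpha>) \<le> ((1/2) ^ n)\<^sup>2 / ((1/2) ^ Suc n) powr (real DIM('a) + \<alpha>)"
    using n1 n2 z assms by (intro frac_le power_mono powr_mono2) auto
  then show "\<exists>n. norm z < (1/2) ^ n \<and>
      \<bar>indicator {z. norm z < 1} z * ((norm z)\<^sup>2 / norm z powr (real DIM('a) + \<alpha>))\<bar>
        \<le> ((1/2) ^ n)\<^sup>2 / ((1/2) ^ Suc n) powr (real DIM('a) + \<alpha>)"
    using n2 z by (intro exI[of _ n]) auto
qed measurable

section \<open>The singular integral\<close>

lemma set_integral_linear_combination:
  fixes f g :: "'a \<Rightarrow> real"
  assumes "set_integrable M A f" "set_integrable M A g"
  shows "(LINT z:A|M. a * f z + b * g z) = a * (LINT z:A|M. f z) + b * (LINT z:A|M. g z)"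
  using assms by (subst set_integral_add(2)) simp_all

text \<open>A class containing both \<open>Cb2\<close> and the barrier, closed under linear
  combinations, on which both parts of the singular integral converge. Asking for a first-order
  remainder bound, uniform in the base point, spares the computation of second derivatives of the
  barrier.\<close>

definition quadratic_approx :: "('a::euclidean_space \<Rightarrow> real) \<Rightarrow> bool" where
  "quadratic_approx f \<longleftrightarrow> bounded (range f) \<and> (\<forall>x. f differentiable (at x)) \<and>
     (\<exists>B. \<forall>x z. \<bar>f (x + z) - f x - frechet_derivative f (at x) z\<bar> \<le> B * (norm z)\<^sup>2)"

lemma differentiable_imp_borel_measurable:
  fixes f :: "'a::euclidean_space \<Rightarrow> real"
  assumes "\<And>x. f differentiable (at x)"
  shows "f \<in> borel_measurable borel"
  using assms by (intro borel_measurable_continuous_onI continuous_at_imp_continuous_on ballI differentiable_imp_continuous_within)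

lemma frechet_derivative_borel_measurable:
  fixes f :: "'a::euclidean_space \<Rightarrow> real"
  assumes "f differentiable (at x)"
  shows "frechet_derivative f (at x) \<in> borel_measurable borel"
  using assms by (intro borel_measurable_continuous_onI linear_continuous_on has_derivative_bounded_linear)
    (simp add: frechet_derivative_works)

text \<open>Two applications of the mean value inequality: the bound on \<open>f''\<close> makes
  \<open>f'\<close> Lipschitz, and then \<open>f\<close> minus its linear part at \<open>x\<close>
  has derivative of norm at most \<open>B * norm z\<close> on the ball of radius
  \<open>norm z\<close>. The factor 1/2 of Taylor's formula is given up.\<close>

lemma Cb2_imp_quadratic_approx:
  fixes f :: "'a::euclidean_space \<Rightarrow> real"
  assumes "f \<in> Cb2"
  shows "quadratic_approx f"
proof -
  obtain f' :: "'a \<Rightarrow> 'a \<Rightarrow>\<^sub>L real" and f'' :: "'a \<Rightarrow> 'a \<Rightarrow>\<^sub>L ('a \<Rightarrow>\<^sub>L real)" where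
    bd: "bounded (range f)" and d1: "\<And>x. (f has_derivative blinfun_apply (f' x)) (at x)"
    and d2: "\<And>x. (f' has_derivative blinfun_apply (f'' x)) (at x)" and b2: "bounded (range f'')"
    using assms unfolding Cb2_def by blast
  obtain B where B: "\<And>x. norm (f'' x) \<le> B" using b2 by (auto simp: bounded_iff)
  have lip: "norm (f' y - f' x) \<le> B * norm (y - x)" for x y
    using B by (intro differentiable_bound[of UNIV f' "\<lambda>x. blinfun_apply (f'' x)"])
      (auto intro: d2 simp: norm_blinfun.rep_eq[symmetric])
  have "0 \<le> B" using B norm_ge_zero order_trans by blast
  have "\<bar>f (x + z) - f x - frechet_derivative f (at x) z\<bar> \<le> B * (norm z)\<^sup>2" for x z
  proof -
    let ?S = "cball x (norm z)"
    have "norm ((f (x + z) - f' x (x + z)) - (f x - f' x x)) \<le> (B * norm z) * norm (x + z - x)"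
    proof (rule differentiable_bound[of ?S "\<lambda>y. f y - f' x y" "\<lambda>y h. (f' y - f' x) h"])
      fix y assume "y \<in> ?S"
      show "((\<lambda>y. f y - f' x y) has_derivative (\<lambda>h. (f' y - f' x) h)) (at y within ?S)"
        unfolding minus_blinfun.rep_eq
        by (intro has_derivative_diff has_derivative_at_withinI[OF d1] bounded_linear.has_derivative[OF blinfun.bounded_linear_right] has_derivative_ident)
      have "norm (f' y - f' x) \<le> B * norm z"
        using lip[of y x] \<open>y \<in> ?S\<close> \<open>0 \<le> B\<close> mult_left_mono[of "norm (y - x)" "norm z" B]
        by (simp add: dist_norm norm_minus_commute)
      then show "onorm (\<lambda>h. (f' y - f' x) h) \<le> B * norm z" by (simp add: norm_blinfun.rep_eq)
    qed (simp_all add: dist_norm)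
    moreover have "frechet_derivative f (at x) = blinfun_apply (f' x)"
      using frechet_derivative_at[OF d1] by simp
    ultimately show ?thesis
      by (simp add: blinfun.add_right power2_eq_square algebra_simps)
  qed
  with bd d1 show ?thesis unfolding quadratic_approx_def differentiable_def by blast
qed

lemma frechet_derivative_linear_combination:
  fixes f g :: "'a::euclidean_space \<Rightarrow> real"
  assumes "f differentiable (at x)" "g differentiable (at x)"
  shows "frechet_derivative (\<lambda>y. a * f y + b * g y) (at x)
    = (\<lambda>z. a * frechet_derivative f (at x) z + b * frechet_derivative g (at x) z)"
  using assms unfolding frechet_derivative_works
  by (intro frechet_derivative_at[symmetric] has_derivative_add has_derivative_mult_right)

lemma quadratic_approx_linear_combination:
  fixes f g :: "'a::euclidean_space \<Rightarrow> real"
  assumes f: "quadratic_approx f" and g: "quadratic_approx g"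
  shows "quadratic_approx (\<lambda>y. a * f y + b * g y)"
proof -
  have df: "f differentiable (at x)" and dg: "g differentiable (at x)" for x
    using f g by (simp_all add: quadratic_approx_def)
  obtain B where B: "\<And>x z. \<bar>f (x + z) - f x - frechet_derivative f (at x) z\<bar> \<le> B * (norm z)\<^sup>2"
    using f by (auto simp: quadratic_approx_def)
  obtain C where C: "\<And>x z. \<bar>g (x + z) - g x - frechet_derivative g (at x) z\<bar> \<le> C * (norm z)\<^sup>2"
    using g by (auto simp: quadratic_approx_def)
  have "\<bar>(a * f (x + z) + b * g (x + z)) - (a * f x + b * g x) - frechet_derivative (\<lambda>y. a * f y + b * g y) (at x) z\<bar>
     \<le> (\<bar>a\<bar> * B + \<bar>b\<bar> * C) * (norm z)\<^sup>2" for x z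
  proof -
    have "\<bar>(a * f (x + z) + b * g (x + z)) - (a * f x + b * g x) - frechet_derivative (\<lambda>y. a * f y + b * g y) (at x) z\<bar>
       = \<bar>a * (f (x + z) - f x - frechet_derivative f (at x) z) + b * (g (x + z) - g x - frechet_derivative g (at x) z)\<bar>"
      by (simp add: frechet_derivative_linear_combination[OF df dg] algebra_simps)
    also have "\<dots> \<le> \<bar>a\<bar> * \<bar>f (x + z) - f x - frechet_derivative f (at x) z\<bar> + \<bar>b\<bar> * \<bar>g (x + z) - g x - frechet_derivative g (at x) z\<bar>"
      using abs_triangle_ineq by (simp flip: abs_mult)
    also have "\<dots> \<le> \<bar>a\<bar> * (B * (norm z)\<^sup>2) + \<bar>b\<bar> * (C * (norm z)\<^sup>2)"
      by (intro add_mono mult_left_mono B C) auto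
    finally show ?thesis by (simp add: algebra_simps)
  qed
  moreover have "bounded (range (\<lambda>y. a * f y + b * g y))"
  proof -
    obtain A A' where "\<And>x. \<bar>f x\<bar> \<le> A" "\<And>x. \<bar>g x\<bar> \<le> A'"
      using f g by (auto simp: quadratic_approx_def bounded_iff)
    then have "\<bar>a * f x + b * g x\<bar> \<le> \<bar>a\<bar> * A + \<bar>b\<bar> * A'" for x
      by (intro order_trans[OF abs_triangle_ineq] add_mono) (auto simp: abs_mult intro: mult_left_mono)
    then show ?thesis by (auto simp: bounded_iff)
  qed
  moreover have "(\<lambda>y. a * f y + b * g y) differentiable (at x)" for x
    using df dg by (intro derivative_intros)
  ultimately show ?thesis unfolding quadratic_approx_def by blast
qed

context
  fixes \<alpha> :: real
  assumes \<alpha>: "0 < \<alpha>" "\<alpha> < 2"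
begin

lemma set_integrable_taylor_remainder:
  fixes g :: "'a::euclidean_space \<Rightarrow> real"
  assumes "\<And>z. \<bar>g z\<bar> \<le> B * (norm z)\<^sup>2" and [measurable]: "g \<in> borel_measurable borel"
  shows "set_integrable lborel {z. norm z < 1} (\<lambda>z. g z / norm z powr (real DIM('a) + \<alpha>))"
  unfolding set_integrable_def
proof (rule Bochner_Integration.integrable_bound[OF integrable_mult_right[OF integrable_norm_powr_inside[OF \<alpha>], of B]])
  show "AE z in lborel. norm (indicator {z. norm z < 1} z *\<^sub>R (g z / norm z powr (real DIM('a) + \<alpha>)))
    \<le> norm (B * (indicator {z. norm z < 1} z * ((norm z)\<^sup>2 / norm z powr (real DIM('a) + \<alpha>))))"
    using assms(1) by (intro AE_I2) (auto simp: indicator_def abs_mult intro!: divide_right_mono order_trans[OF assms(1)] mult_right_mono)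
qed measurable

lemma set_integrable_bounded_tail:
  fixes g :: "'a::euclidean_space \<Rightarrow> real"
  assumes "\<And>z. \<bar>g z\<bar> \<le> A" and [measurable]: "g \<in> borel_measurable borel"
  shows "set_integrable lborel {z. 1 \<le> norm z} (\<lambda>z. g z / norm z powr (real DIM('a) + \<alpha>))"
  unfolding set_integrable_def
proof (rule Bochner_Integration.integrable_bound[OF integrable_mult_right[OF integrable_norm_powr_outside[OF \<alpha>(1)], of A]])
  show "AE z in lborel. norm (indicator {z. 1 \<le> norm z} z *\<^sub>R (g z / norm z powr (real DIM('a) + \<alpha>)))
    \<le> norm (A * (indicator {z. 1 \<le> norm z} z * (1 / norm z powr (real DIM('a) + \<alpha>))))"
    using assms(1) by (intro AE_I2) (auto simp: indicator_def abs_mult intro!: divide_right_mono order_trans[OF assms(1)])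
qed measurable

lemma set_integrable_kernel:
  fixes f :: "'a::euclidean_space \<Rightarrow> real"
  assumes f: "quadratic_approx f"
  shows "set_integrable lborel {z. norm z < 1}
      (\<lambda>z. (f (x + z) - f x - frechet_derivative f (at x) z) / norm z powr (real DIM('a) + \<alpha>))"
    and "set_integrable lborel {z. 1 \<le> norm z} (\<lambda>z. (f (x + z) - f x) / norm z powr (real DIM('a) + \<alpha>))"
proof -
  have diff: "\<And>x. f differentiable (at x)" using f by (simp add: quadratic_approx_def)
  have [measurable]: "f \<in> borel_measurable borel" "frechet_derivative f (at x) \<in> borel_measurable borel"
    using differentiable_imp_borel_measurable[OF diff] frechet_derivative_borel_measurable[OF diff] by auto
  obtain B where B: "\<And>x z. \<bar>f (x + z) - f x - frechet_derivative f (at x) z\<bar> \<le> B * (norm z)\<^sup>2"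
    using f by (auto simp: quadratic_approx_def)
  show "set_integrable lborel {z. norm z < 1}
      (\<lambda>z. (f (x + z) - f x - frechet_derivative f (at x) z) / norm z powr (real DIM('a) + \<alpha>))"
    by (rule set_integrable_taylor_remainder[OF B]) measurable
  obtain A where A: "\<And>x. \<bar>f x\<bar> \<le> A" using f by (auto simp: quadratic_approx_def bounded_iff)
  have "\<bar>f (x + z) - f x\<bar> \<le> 2 * A" for z
    using A[of "x + z"] A[of x] by linarith
  then show "set_integrable lborel {z. 1 \<le> norm z} (\<lambda>z. (f (x + z) - f x) / norm z powr (real DIM('a) + \<alpha>))"
    by (rule set_integrable_bounded_tail) measurable
qed

lemma frac_laplace_kernel_linear_combination:
  fixes f g :: "'a::euclidean_space \<Rightarrow> real"
  assumes f: "quadratic_approx f" and g: "quadratic_approx g"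
  shows "frac_laplace_kernel \<alpha> 1 (\<lambda>y. a * f y + b * g y) x
    = a * frac_laplace_kernel \<alpha> 1 f x + b * frac_laplace_kernel \<alpha> 1 g x"
proof -
  have df: "f differentiable (at x)" and dg: "g differentiable (at x)"
    using f g by (simp_all add: quadratic_approx_def)
  let ?p = "\<lambda>z::'a. norm z powr (real DIM('a) + \<alpha>)"
  have "(LINT z : {z. norm z < 1} | lborel. (a * f (x + z) + b * g (x + z) - (a * f x + b * g x)
      - frechet_derivative (\<lambda>y. a * f y + b * g y) (at x) z) / ?p z)
    = (LINT z : {z. norm z < 1} | lborel. a * ((f (x + z) - f x - frechet_derivative f (at x) z) / ?p z)
       + b * ((g (x + z) - g x - frechet_derivative g (at x) z) / ?p z))"
    by (intro set_lebesgue_integral_cong) (auto simp: frechet_derivative_linear_combination[OF df dg] diff_divide_distrib add_divide_distrib algebra_simps)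
  also have "\<dots> = a * (LINT z : {z. norm z < 1} | lborel. (f (x + z) - f x - frechet_derivative f (at x) z) / ?p z)
       + b * (LINT z : {z. norm z < 1} | lborel. (g (x + z) - g x - frechet_derivative g (at x) z) / ?p z)"
    by (intro set_integral_linear_combination set_integrable_kernel(1) f g)
  finally have 1: "(LINT z : {z. norm z < 1} | lborel. (a * f (x + z) + b * g (x + z) - (a * f x + b * g x)
      - frechet_derivative (\<lambda>y. a * f y + b * g y) (at x) z) / ?p z) = \<dots>" .
  have "(LINT z : {z. 1 \<le> norm z} | lborel. (a * f (x + z) + b * g (x + z) - (a * f x + b * g x)) / ?p z)
    = (LINT z : {z. 1 \<le> norm z} | lborel. a * ((f (x + z) - f x) / ?p z) + b * ((g (x + z) - g x) / ?p z))"
    by (intro set_lebesgue_integral_cong) (auto simp: diff_divide_distrib add_divide_distrib algebra_simps)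
  also have "\<dots> = a * (LINT z : {z. 1 \<le> norm z} | lborel. (f (x + z) - f x) / ?p z)
       + b * (LINT z : {z. 1 \<le> norm z} | lborel. (g (x + z) - g x) / ?p z)"
    by (intro set_integral_linear_combination set_integrable_kernel(2) f g)
  finally show ?thesis unfolding frac_laplace_kernel_def 1 by (simp add: algebra_simps)
qed

text \<open>At a minimum the gradient term vanishes and both integrands become nonnegative. The
  minimum must be global, since the tail integral sees values of \<open>f\<close> arbitrarily far
  away.\<close>

lemma frac_laplace_kernel_nonneg_at_min:
  fixes f :: "'a::euclidean_space \<Rightarrow> real"
  assumes "f differentiable (at x)" and min: "\<And>y. f x \<le> f y"
  shows "0 \<le> frac_laplace_kernel \<alpha> 1 f x"
proof -
  have "frechet_derivative f (at x) = (\<lambda>z. 0)"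
    using assms by (intro differential_zero_maxmin[of x UNIV f]) (auto simp: frechet_derivative_works)
  then show ?thesis
    unfolding frac_laplace_kernel_def set_lebesgue_integral_def
    by (auto intro!: add_nonneg_nonneg integral_nonneg_AE AE_I2 divide_nonneg_nonneg mult_nonneg_nonneg simp: min)
qed

text \<open>Dividing growth of order \<open>\<alpha> - \<beta>\<close> by the kernel leaves the
  exponent \<open>DIM('a) + \<beta>\<close>, which is integrable at infinity. The two integrals do
  not depend on \<open>f\<close> or \<open>x\<close>, so smallness of \<open>B\<close> and
  \<open>C\<close> passes to the operator.\<close>

lemma frac_laplace_kernel_bound:
  fixes f :: "'a::euclidean_space \<Rightarrow> real"
  assumes f: "quadratic_approx f" and "0 < \<beta>"
    and B: "\<And>z. \<bar>f (x + z) - f x - frechet_derivative f (at x) z\<bar> \<le> B * (norm z)\<^sup>2"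
    and C: "\<And>z. \<bar>f (x + z) - f x\<bar> \<le> C * norm z powr (\<alpha> - \<beta>)"
  shows "\<bar>frac_laplace_kernel \<alpha> 1 f x\<bar>
    \<le> B * (LINT z|lborel. indicator {z::'a. norm z < 1} z * ((norm z)\<^sup>2 / norm z powr (real DIM('a) + \<alpha>)))
     + C * (LINT z|lborel. indicator {z::'a. 1 \<le> norm z} z * (1 / norm z powr (real DIM('a) + \<beta>)))"
proof -
  let ?p = "\<lambda>z::'a. norm z powr (real DIM('a) + \<alpha>)"
  have "\<bar>LINT z : {z. norm z < 1} | lborel. (f (x + z) - f x - frechet_derivative f (at x) z) / ?p z\<bar>
    \<le> (LINT z|lborel. B * (indicator {z. norm z < 1} z * ((norm z)\<^sup>2 / ?p z)))"
    unfolding set_lebesgue_integral_def real_norm_def[symmetric]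
  proof (rule Bochner_Integration.integral_norm_bound_integral[OF _ integrable_mult_right[OF integrable_norm_powr_inside[OF \<alpha>]]])
    show "integrable lborel (\<lambda>z. indicator {z. norm z < 1} z *\<^sub>R ((f (x + z) - f x - frechet_derivative f (at x) z) / ?p z))"
      using set_integrable_kernel(1)[OF f] by (simp add: set_integrable_def)
    show "norm (indicator {z. norm z < 1} z *\<^sub>R ((f (x + z) - f x - frechet_derivative f (at x) z) / ?p z))
       \<le> B * (indicator {z. norm z < 1} z * ((norm z)\<^sup>2 / ?p z))" for z
      using B[of z] by (auto simp: indicator_def intro!: divide_right_mono)
  qed
  moreover have "\<bar>LINT z : {z. 1 \<le> norm z} | lborel. (f (x + z) - f x) / ?p z\<bar>
    \<le> (LINT z|lborel. C * (indicator {z::'a. 1 \<le> norm z} z * (1 / norm z powr (real DIM('a) + \<beta>))))"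
    unfolding set_lebesgue_integral_def real_norm_def[symmetric]
  proof (rule Bochner_Integration.integral_norm_bound_integral[OF _ integrable_mult_right[OF integrable_norm_powr_outside[OF \<open>0 < \<beta>\<close>]]])
    show "integrable lborel (\<lambda>z. indicator {z. 1 \<le> norm z} z *\<^sub>R ((f (x + z) - f x) / ?p z))"
      using set_integrable_kernel(2)[OF f] by (simp add: set_integrable_def)
    show "norm (indicator {z. 1 \<le> norm z} z *\<^sub>R ((f (x + z) - f x) / ?p z))
       \<le> C * (indicator {z. 1 \<le> norm z} z * (1 / norm z powr (real DIM('a) + \<beta>)))" for z
    proof (cases "1 \<le> norm z")
      case True
      have "\<bar>f (x + z) - f x\<bar> / ?p z \<le> C * norm z powr (\<alpha> - \<beta>) / ?p z"
        by (intro divide_right_mono C) simp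
      also have "\<dots> = C / norm z powr (real DIM('a) + \<beta>)"
        using True by (simp add: powr_diff powr_add)
      finally show ?thesis using True by simp
    qed simp
  qed
  ultimately show ?thesis unfolding frac_laplace_kernel_def integral_mult_right_zero by linarith
qed

end

section \<open>The normalizing constant\<close>

lemma integral_lborel_odd_eq_0:
  fixes g :: "'a::euclidean_space \<Rightarrow> real"
  assumes [measurable]: "g \<in> borel_measurable borel" and odd: "\<And>z. g (- z) = - g z"
  shows "(LINT z|lborel. g z) = 0"
  using integral_lborel_scaleR[of "-1" g] by (simp add: odd)

lemma set_integral_ball_complement:
  fixes g :: "'a::euclidean_space \<Rightarrow> real"
  assumes "set_integrable lborel {z. norm z < 1} g" "set_integrable lborel {z. 1 \<le> norm z} g"
  shows "integrable lborel g"
    and "(LINT z : {z. norm z < 1} | lborel. g z) + (LINT z : {z. 1 \<le> norm z} | lborel. g z) = (LINT z|lborel. g z)"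
proof -
  have U: "{z. norm z < 1} \<union> {z. 1 \<le> norm z} = (UNIV :: 'a set)" by auto
  have "set_integrable lborel ({z. norm z < 1} \<union> {z. 1 \<le> norm z}) g"
    by (rule set_integrable_Un[OF assms]) simp_all
  then show "integrable lborel g" by (simp add: U set_integrable_def)
  have "(LINT z : {z. norm z < 1} \<union> {z. 1 \<le> norm z} | lborel. g z)
      = (LINT z : {z. norm z < 1} | lborel. g z) + (LINT z : {z. 1 \<le> norm z} | lborel. g z)"
    by (rule set_integral_Un[OF _ assms]) auto
  then show "(LINT z : {z. norm z < 1} | lborel. g z) + (LINT z : {z. 1 \<le> norm z} | lborel. g z) = (LINT z|lborel. g z)"
    by (simp add: U set_lebesgue_integral_def)
qed

lemma one_minus_cos_le: "1 - cos x \<le> (x::real)\<^sup>2"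
proof -
  have "1 - cos x = 2 * (sin (x / 2))\<^sup>2" using cos_double_sin[of "x/2"] by simp
  also have "(sin (x / 2))\<^sup>2 \<le> (x / 2)\<^sup>2"
    using power_mono[OF abs_sin_x_le_abs_x[of "x/2"], of 2] by (simp add: power_divide)
  also have "2 * (x / 2)\<^sup>2 \<le> x\<^sup>2" by (simp add: power_divide)
  finally show ?thesis by simp
qed

lemma abs_sin_minus_self_le: "\<bar>sin x - x\<bar> \<le> (x::real)\<^sup>2"
proof -
  have eq: "(\<Sum>m<2. sin_coeff m * x ^ m) = x"
    by (simp add: numeral_2_eq_2 sin_coeff_def)
  then have "\<bar>sin x - x\<bar> \<le> x\<^sup>2 / 2"
    using Maclaurin_sin_bound[of x 2] unfolding eq by (simp add: field_simps)
  also have "\<dots> \<le> x\<^sup>2" by simp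
  finally show ?thesis .
qed

lemma inner_power2_le: "(x \<bullet> z)\<^sup>2 \<le> (norm x)\<^sup>2 * (norm z)\<^sup>2"
  using power_mono[OF Cauchy_Schwarz_ineq2[of x z], of 2] by (simp add: power_mult_distrib)

text \<open>The Levy-Khintchine exponent of the unnormalized kernel, that is, minus its Fourier
  symbol. It is a single integral without gradient correction, because \<open>1 - cos\<close> is
  already quadratic at the origin.\<close>

definition levy_symbol :: "real \<Rightarrow> 'a::euclidean_space \<Rightarrow> real" where
  "levy_symbol \<alpha> \<xi> = (LINT z|lborel. (1 - cos (\<xi> \<bullet> z)) / norm z powr (real DIM('a) + \<alpha>))"

context
  fixes \<alpha> :: real
  assumes \<alpha>: "0 < \<alpha>" "\<alpha> < 2"
begin

lemma set_integrable_one_minus_cos: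
  fixes \<xi> :: "'a::euclidean_space"
  shows "set_integrable lborel {z. norm z < 1} (\<lambda>z. (1 - cos (\<xi> \<bullet> z)) / norm z powr (real DIM('a) + \<alpha>))"
    and "set_integrable lborel {z. 1 \<le> norm z} (\<lambda>z. (1 - cos (\<xi> \<bullet> z)) / norm z powr (real DIM('a) + \<alpha>))"
proof -
  show "set_integrable lborel {z. norm z < 1} (\<lambda>z. (1 - cos (\<xi> \<bullet> z)) / norm z powr (real DIM('a) + \<alpha>))"
  proof (rule set_integrable_taylor_remainder[OF \<alpha>])
    show "\<bar>1 - cos (\<xi> \<bullet> z)\<bar> \<le> (norm \<xi>)\<^sup>2 * (norm z)\<^sup>2" for z
      using one_minus_cos_le[of "\<xi> \<bullet> z"] inner_power2_le[of \<xi> z] by simp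
  qed measurable
  show "set_integrable lborel {z. 1 \<le> norm z} (\<lambda>z. (1 - cos (\<xi> \<bullet> z)) / norm z powr (real DIM('a) + \<alpha>))"
  proof (rule set_integrable_bounded_tail[OF \<alpha>])
    show "\<bar>1 - cos (\<xi> \<bullet> z)\<bar> \<le> 2" for z
      using cos_ge_minus_one[of "\<xi> \<bullet> z"] cos_le_one[of "\<xi> \<bullet> z"] by linarith
  qed measurable
qed

text \<open>The addition formula splits the increment of the wave into a multiple of
  \<open>1 - cos (\<xi> \<bullet> z)\<close>, which yields the symbol, and a multiple of an odd
  function of \<open>z\<close>, whose integral vanishes.\<close>

lemma frac_laplace_kernel_cos:
  fixes \<xi> x :: "'a::euclidean_space"
  shows "frac_laplace_kernel \<alpha> 1 (\<lambda>y. cos (\<xi> \<bullet> y)) x = - levy_symbol \<alpha> \<xi> * cos (\<xi> \<bullet> x)"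
proof -
  let ?p = "\<lambda>z::'a. norm z powr (real DIM('a) + \<alpha>)"
  let ?a = "cos (\<xi> \<bullet> x)" and ?b = "sin (\<xi> \<bullet> x)"
  have D: "frechet_derivative (\<lambda>y. cos (\<xi> \<bullet> y)) (at x) = (\<lambda>z. - ?b * (\<xi> \<bullet> z))"
    by (rule frechet_derivative_at[symmetric]) (auto intro!: derivative_eq_intros)
  \<comment> \<open>The gradient term stays paired with the sine: each alone is only of first order
    at the origin and in general fails to be integrable there when \<alpha> \<ge> 1.\<close>
  have i1: "set_integrable lborel {z. norm z < 1} (\<lambda>z. (sin (\<xi> \<bullet> z) - \<xi> \<bullet> z) / ?p z)"
  proof (rule set_integrable_taylor_remainder[OF \<alpha>])
    show "\<bar>sin (\<xi> \<bullet> z) - \<xi> \<bullet> z\<bar> \<le> (norm \<xi>)\<^sup>2 * (norm z)\<^sup>2" for z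
      using abs_sin_minus_self_le[of "\<xi> \<bullet> z"] inner_power2_le[of \<xi> z] by simp
  qed measurable
  have i2: "set_integrable lborel {z. 1 \<le> norm z} (\<lambda>z. sin (\<xi> \<bullet> z) / ?p z)"
    by (rule set_integrable_bounded_tail[OF \<alpha>, where A=1]) simp_all
  have o1: "(LINT z : {z. norm z < 1} | lborel. (sin (\<xi> \<bullet> z) - \<xi> \<bullet> z) / ?p z) = 0"
    unfolding set_lebesgue_integral_def
    by (rule integral_lborel_odd_eq_0) (measurable, simp add: indicator_def diff_divide_distrib)
  have o2: "(LINT z : {z. 1 \<le> norm z} | lborel. sin (\<xi> \<bullet> z) / ?p z) = 0"
    unfolding set_lebesgue_integral_def
    by (rule integral_lborel_odd_eq_0) (measurable, simp add: indicator_def)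
  have "(LINT z : {z. norm z < 1} | lborel. (cos (\<xi> \<bullet> (x + z)) - ?a - - ?b * (\<xi> \<bullet> z)) / ?p z)
    = (LINT z : {z. norm z < 1} | lborel. (- ?a) * ((1 - cos (\<xi> \<bullet> z)) / ?p z) + (- ?b) * ((sin (\<xi> \<bullet> z) - \<xi> \<bullet> z) / ?p z))"
    by (intro set_lebesgue_integral_cong)
      (auto simp: inner_add_right cos_add diff_divide_distrib add_divide_distrib algebra_simps)
  also have "\<dots> = (- ?a) * (LINT z : {z. norm z < 1} | lborel. (1 - cos (\<xi> \<bullet> z)) / ?p z)"
    unfolding set_integral_linear_combination[OF set_integrable_one_minus_cos(1) i1] o1 by simp
  finally have 1: "(LINT z : {z. norm z < 1} | lborel. (cos (\<xi> \<bullet> (x + z)) - ?a - - ?b * (\<xi> \<bullet> z)) / ?p z) = \<dots>" .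
  have "(LINT z : {z. 1 \<le> norm z} | lborel. (cos (\<xi> \<bullet> (x + z)) - ?a) / ?p z)
    = (LINT z : {z. 1 \<le> norm z} | lborel. (- ?a) * ((1 - cos (\<xi> \<bullet> z)) / ?p z) + (- ?b) * (sin (\<xi> \<bullet> z) / ?p z))"
    by (intro set_lebesgue_integral_cong)
      (auto simp: inner_add_right cos_add diff_divide_distrib add_divide_distrib algebra_simps)
  also have "\<dots> = (- ?a) * (LINT z : {z. 1 \<le> norm z} | lborel. (1 - cos (\<xi> \<bullet> z)) / ?p z)"
    unfolding set_integral_linear_combination[OF set_integrable_one_minus_cos(2) i2] o2 by simp
  finally have "frac_laplace_kernel \<alpha> 1 (\<lambda>y. cos (\<xi> \<bullet> y)) x
     = (- ?a) * ((LINT z : {z. norm z < 1} | lborel. (1 - cos (\<xi> \<bullet> z)) / ?p z)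
               + (LINT z : {z. 1 \<le> norm z} | lborel. (1 - cos (\<xi> \<bullet> z)) / ?p z))"
    unfolding frac_laplace_kernel_def D 1 by (simp add: algebra_simps)
  then show ?thesis
    unfolding set_integral_ball_complement(2)[OF set_integrable_one_minus_cos] levy_symbol_def by simp
qed

text \<open>The integrand is nonnegative, so a zero integral would give
  \<open>cos (\<xi> \<bullet> z) = 1\<close> almost everywhere. That condition is closed, hence
  would hold everywhere, but at \<open>z = (pi / (\<xi> \<bullet> \<xi>)) *\<^sub>R \<xi>\<close>
  the cosine is -1.\<close>

lemma levy_symbol_pos:
  fixes \<xi> :: "'a::euclidean_space"
  assumes "\<xi> \<noteq> 0"
  shows "0 < levy_symbol \<alpha> \<xi>"
proof -
  let ?g = "\<lambda>z. (1 - cos (\<xi> \<bullet> z)) / norm z powr (real DIM('a) + \<alpha>)"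
  have int: "integrable lborel ?g"
    by (rule set_integral_ball_complement(1)[OF set_integrable_one_minus_cos])
  have "0 \<le> levy_symbol \<alpha> \<xi>"
    unfolding levy_symbol_def by (intro integral_nonneg_AE AE_I2) simp
  moreover have "levy_symbol \<alpha> \<xi> \<noteq> 0"
  proof
    assume "levy_symbol \<alpha> \<xi> = 0"
    then have "AE z in lborel. ?g z = 0"
      unfolding levy_symbol_def by (subst (asm) integral_nonneg_eq_0_iff_AE[OF int]) simp_all
    then have "AE z in lborel. z \<in> {z. cos (\<xi> \<bullet> z) = 1}" by eventually_elim auto
    then have "AE z in lebesgue. z \<in> {z. cos (\<xi> \<bullet> z) = 1}" by (rule AE_completion)
    moreover have "closed {z. cos (\<xi> \<bullet> z) = 1}"
      by (intro closed_Collect_eq continuous_intros)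
    ultimately have "(pi / (\<xi> \<bullet> \<xi>)) *\<^sub>R \<xi> \<in> {z. cos (\<xi> \<bullet> z) = 1}"
      by (intro mem_closed_if_AE_lebesgue)
    then show False using assms by simp
  qed
  ultimately show ?thesis by simp
qed

text \<open>Substituting \<open>z / r\<close> for \<open>z\<close> produces the Jacobian
  \<open>r\<close> to the power \<open>- DIM('a)\<close>, while the kernel contributes
  \<open>r powr (DIM('a) + \<alpha>)\<close>.\<close>

lemma levy_symbol_scaleR:
  fixes \<xi> :: "'a::euclidean_space"
  assumes "0 < r"
  shows "levy_symbol \<alpha> (r *\<^sub>R \<xi>) = r powr \<alpha> * levy_symbol \<alpha> \<xi>"
proof -
  have "levy_symbol \<alpha> (r *\<^sub>R \<xi>) = \<bar>1 / r\<bar> ^ DIM('a) *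
     (LINT z|lborel. (1 - cos (r *\<^sub>R \<xi> \<bullet> ((1 / r) *\<^sub>R z))) / norm ((1 / r) *\<^sub>R z) powr (real DIM('a) + \<alpha>))"
    unfolding levy_symbol_def using assms by (intro integral_lborel_scaleR) simp_all
  also have "(\<lambda>z. (1 - cos (r *\<^sub>R \<xi> \<bullet> ((1 / r) *\<^sub>R z))) / norm ((1 / r) *\<^sub>R z) powr (real DIM('a) + \<alpha>))
    = (\<lambda>z. r powr (real DIM('a) + \<alpha>) * ((1 - cos (\<xi> \<bullet> z)) / norm z powr (real DIM('a) + \<alpha>)))"
    using assms by (auto simp: powr_divide fun_eq_iff)
  also have "\<bar>1 / r\<bar> ^ DIM('a) * (LINT z|lborel. \<dots> z)
    = (1 / r) ^ DIM('a) * r powr (real DIM('a) + \<alpha>) * levy_symbol \<alpha> \<xi>"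
    unfolding levy_symbol_def using assms by (simp del: times_divide_eq_right)
  also have "(1 / r) ^ DIM('a) * r powr (real DIM('a) + \<alpha>) = r powr \<alpha>"
    using assms by (simp add: powr_add powr_realpow power_divide)
  finally show ?thesis .
qed

lemma levy_symbol_orthogonal:
  fixes f :: "'a::euclidean_space \<Rightarrow> 'a"
  assumes f: "orthogonal_transformation f"
  shows "levy_symbol \<alpha> (f \<xi>) = levy_symbol \<alpha> \<xi>"
proof -
  have [measurable]: "f \<in> borel_measurable borel"
    using orthogonal_transformation_linear[OF f]
    by (intro borel_measurable_continuous_onI) (simp add: linear_continuous_on linear_linear)
  let ?g = "\<lambda>z. (1 - cos (f \<xi> \<bullet> z)) / norm z powr (real DIM('a) + \<alpha>)"
  have "levy_symbol \<alpha> (f \<xi>) = (LINT z|distr lborel borel f. ?g z)"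
    unfolding levy_symbol_def lborel_distr_orthogonal[OF f] ..
  also have "\<dots> = (LINT z|lborel. ?g (f z))"
    by (rule integral_distr) simp_all
  also have "\<dots> = levy_symbol \<alpha> \<xi>"
    using f by (simp add: levy_symbol_def orthogonal_transformation_norm orthogonal_transformation_def)
  finally show ?thesis .
qed

text \<open>A rotation carries \<open>norm \<xi> *\<^sub>R e\<close> to \<xi>, and homogeneity
  extracts the length.\<close>

lemma levy_symbol_eq:
  fixes \<xi> e :: "real ^ 'n"
  assumes "norm e = 1"
  shows "levy_symbol \<alpha> \<xi> = norm \<xi> powr \<alpha> * levy_symbol \<alpha> e"
proof (cases "\<xi> = 0")
  case True
  then show ?thesis by (simp add: levy_symbol_def)
next
  case False
  obtain f where f: "orthogonal_transformation f" "f (norm \<xi> *\<^sub>R e) = \<xi>"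
    by (rule orthogonal_transformation_exists[of "norm \<xi> *\<^sub>R e" \<xi>]) (use assms in auto)
  show ?thesis
    using levy_symbol_orthogonal[OF f(1), of "norm \<xi> *\<^sub>R e"] levy_symbol_scaleR[of "norm \<xi>" e] False f(2) by simp
qed

text \<open>Positivity is part of the defining property, but a \<open>THE\<close> term has that
  property only after unique existence is shown. The reciprocal of the symbol at a unit vector
  \<open>e\<close> is a witness; testing the plane wave with frequency \<open>e\<close> at the
  origin forces it.\<close>

lemma frac_laplace_const_pos: "0 < frac_laplace_const TYPE(real ^ 'n) \<alpha>"
proof -
  define e :: "real ^ 'n" where "e = axis undefined 1"
  have e: "norm e = 1" by (simp add: e_def)
  then have "e \<noteq> 0" by auto
  let ?P = "\<lambda>c. 0 < c \<and> (\<forall>\<xi> x :: real ^ 'n. c * frac_laplace_kernel \<alpha> 1 (\<lambda>y. cos (\<xi> \<bullet> y)) x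
                    = - (norm \<xi> powr \<alpha>) * cos (\<xi> \<bullet> x))"
  have pos: "0 < levy_symbol \<alpha> e" by (rule levy_symbol_pos) fact
  have "\<exists>!c. ?P c"
  proof (rule ex1I)
    have "1 / levy_symbol \<alpha> e * frac_laplace_kernel \<alpha> 1 (\<lambda>y. cos (\<xi> \<bullet> y)) x = - (norm \<xi> powr \<alpha>) * cos (\<xi> \<bullet> x)"
      for \<xi> x :: "real ^ 'n"
      using pos by (simp add: frac_laplace_kernel_cos levy_symbol_eq[OF e, of \<xi>])
    then show "?P (1 / levy_symbol \<alpha> e)" using pos by simp
    fix c assume "?P c"
    then have "c * frac_laplace_kernel \<alpha> 1 (\<lambda>y. cos (e \<bullet> y)) 0 = - (norm e powr \<alpha>) * cos (e \<bullet> 0)" by blast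
    then show "c = 1 / levy_symbol \<alpha> e"
      using pos e by (simp add: frac_laplace_kernel_cos field_simps)
  qed
  from theI'[OF this] show ?thesis unfolding frac_laplace_const_def by (rule conjunct1)
qed

end

section \<open>The barrier\<close>

text \<open>The parameter \<open>s\<close> is an inverse length: the barrier is at least 1/2 outside
  the ball of radius \<open>1 / s\<close>, yet at every fixed point it tends to 0 as
  \<open>s\<close> does.\<close>

definition barrier :: "real \<Rightarrow> 'a::euclidean_space \<Rightarrow> real" where
  "barrier s x = 1 - 1 / (1 + (norm (s *\<^sub>R x))\<^sup>2)"

lemma barrier_nonneg: "0 \<le> barrier s x" and barrier_le_1: "barrier s x \<le> 1"
proof -
  have "0 < 1 + (norm (s *\<^sub>R x))\<^sup>2" by (rule add_pos_nonneg) simp_all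
  then show "0 \<le> barrier s x" "barrier s x \<le> 1" unfolding barrier_def by (simp_all del: norm_scaleR)
qed

lemma barrier_ge_half:
  assumes "0 < s" "1 / s \<le> norm x"
  shows "1 / 2 \<le> barrier s x"
proof -
  have "1 \<le> norm (s *\<^sub>R x)" using assms by (simp add: field_simps)
  then have "1 \<le> (norm (s *\<^sub>R x))\<^sup>2" by (rule one_le_power)
  then show ?thesis by (simp add: barrier_def field_simps)
qed

text \<open>Everything follows from \<open>q (y + w) - q y = - (q y * q (y + w)) * (2 * (y \<bullet>
  w) + (norm w)\<^sup>2)\<close> together with \<open>q \<le> 1\<close> and
  \<open>norm y * q y \<le> 1 / 2\<close>. In the second bound
  \<open>- 2 * (y \<bullet> w) * (q y)\<^sup>2\<close> is the derivative of \<open>q\<close> at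
  \<open>y\<close> in direction \<open>w\<close>.\<close>

lemma inverse_one_plus_norm_expansion:
  fixes y w :: "'a::euclidean_space"
  defines "q \<equiv> \<lambda>y::'a. 1 / (1 + (norm y)\<^sup>2)"
  shows "\<bar>q (y + w) - q y\<bar> \<le> norm w"
    and "\<bar>q (y + w) - q y + 2 * (y \<bullet> w) * (q y)\<^sup>2\<bar> \<le> 2 * (norm w)\<^sup>2"
proof -
  have pos: "0 < 1 + (norm y)\<^sup>2" for y :: 'a by (simp add: add_pos_nonneg)
  have q0: "0 < q y" and q1: "q y \<le> 1" and qn: "norm y * q y \<le> 1 / 2" for y
  proof -
    show "0 < q y" "q y \<le> 1" using pos[of y] by (simp_all add: q_def)
    have "0 \<le> (norm y - 1)\<^sup>2" by simp
    then have "2 * norm y \<le> 1 + (norm y)\<^sup>2" by (simp add: power2_eq_square algebra_simps)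
    then show "norm y * q y \<le> 1 / 2" using pos[of y] by (simp add: q_def field_simps)
  qed
  let ?Q = "q y" and ?R = "q (y + w)"
  have QR: "?Q * ?R \<le> 1" "0 \<le> ?Q * ?R"
    using mult_mono[OF q1[of y] q1[of "y + w"]] q0[of y] q0[of "y+w"] by auto
  have "?R - ?Q = - (?Q * ?R) * ((1 + (norm (y + w))\<^sup>2) - (1 + (norm y)\<^sup>2))"
    using pos[of y] pos[of "y + w"] unfolding q_def by (simp add: divide_simps)
  also have "(1 + (norm (y + w))\<^sup>2) - (1 + (norm y)\<^sup>2) = 2 * (y \<bullet> w) + (norm w)\<^sup>2"
    by (simp add: power2_norm_eq_inner inner_simps inner_commute)
  finally have eq: "?R - ?Q = - (?Q * ?R) * (2 * (y \<bullet> w) + (norm w)\<^sup>2)" .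
  \<comment> \<open>This symmetric form lets \<open>norm y\<close> be paired with \<open>q y\<close>
    and \<open>norm (y + w)\<close> with \<open>q (y + w)\<close>, each product being at most
    1/2.\<close>
  have "2 * (y \<bullet> w) + (norm w)\<^sup>2 = (y + (y + w)) \<bullet> w"
    by (simp add: power2_norm_eq_inner inner_simps)
  then have "\<bar>2 * (y \<bullet> w) + (norm w)\<^sup>2\<bar> \<le> norm (y + (y + w)) * norm w"
    using Cauchy_Schwarz_ineq2 by metis
  also have "\<dots> \<le> (norm y + norm (y + w)) * norm w"
    by (intro mult_right_mono norm_triangle_ineq) simp
  finally have "\<bar>?R - ?Q\<bar> \<le> (?Q * ?R) * ((norm y + norm (y + w)) * norm w)"
    unfolding eq using QR by (simp add: abs_mult abs_of_pos q0 mult_left_mono)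
  also have "\<dots> = ((norm y * ?Q) * ?R + (norm (y + w) * ?R) * ?Q) * norm w"
    by (simp add: algebra_simps)
  also have "\<dots> \<le> (1 / 2 * 1 + 1 / 2 * 1) * norm w"
    using q0 q1 qn by (intro mult_right_mono add_mono mult_mono) (auto intro: less_imp_le)
  finally show *: "\<bar>?R - ?Q\<bar> \<le> norm w" by simp
  \<comment> \<open>Replacing \<open>?R\<close> by \<open>?Q\<close> in the linear term costs a
    factor \<open>?Q - ?R\<close>, which the first bound has just estimated.\<close>
  have "?R - ?Q + 2 * (y \<bullet> w) * ?Q\<^sup>2 = 2 * (y \<bullet> w) * ?Q * (?Q - ?R) - (?Q * ?R) * (norm w)\<^sup>2"
    using eq by (simp add: algebra_simps power2_eq_square)
  also have "\<bar>\<dots>\<bar> \<le> \<bar>2 * (y \<bullet> w) * ?Q\<bar> * \<bar>?Q - ?R\<bar> + (?Q * ?R) * (norm w)\<^sup>2"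
    using abs_triangle_ineq4[of "2 * (y \<bullet> w) * ?Q * (?Q - ?R)" "(?Q * ?R) * (norm w)\<^sup>2"] by (simp add: abs_mult abs_of_pos q0)
  also have "\<dots> \<le> norm w * norm w + 1 * (norm w)\<^sup>2"
  proof (intro add_mono mult_mono QR)
    have "\<bar>2 * (y \<bullet> w) * ?Q\<bar> \<le> 2 * (norm y * norm w) * ?Q"
      using q0[of y] Cauchy_Schwarz_ineq2[of y w] by (simp add: abs_mult)
    also have "\<dots> = 2 * (norm y * ?Q) * norm w" by simp
    also have "\<dots> \<le> 1 * norm w" using qn[of y] by (intro mult_right_mono) auto
    finally show "\<bar>2 * (y \<bullet> w) * ?Q\<bar> \<le> norm w" by simp
    show "\<bar>?Q - ?R\<bar> \<le> norm w" using * by (simp add: abs_minus_commute)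
  qed simp_all
  finally show "\<bar>?R - ?Q + 2 * (y \<bullet> w) * ?Q\<^sup>2\<bar> \<le> 2 * (norm w)\<^sup>2" by (simp add: power2_eq_square)
qed

lemma has_derivative_barrier:
  "(barrier s has_derivative (\<lambda>z. 2 * s\<^sup>2 * (x \<bullet> z) * (1 / (1 + (norm (s *\<^sub>R x))\<^sup>2))\<^sup>2)) (at x)"
proof -
  have "1 + (norm (s *\<^sub>R x))\<^sup>2 \<noteq> 0" by (smt (verit) zero_le_power2)
  then have "((\<lambda>x. 1 - 1 / (1 + (s *\<^sub>R x) \<bullet> (s *\<^sub>R x))) has_derivative (\<lambda>z. 2 * s\<^sup>2 * (x \<bullet> z) * (1 / (1 + (norm (s *\<^sub>R x))\<^sup>2))\<^sup>2)) (at x)"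
    unfolding power2_norm_eq_inner
    by (auto intro!: derivative_eq_intros simp: fun_eq_iff field_simps power2_eq_square inner_commute)
  then show ?thesis unfolding barrier_def power2_norm_eq_inner .
qed

lemma barrier_taylor:
  "\<bar>barrier s (x + z) - barrier s x - frechet_derivative (barrier s) (at x) z\<bar> \<le> 2 * s\<^sup>2 * (norm z)\<^sup>2"
proof -
  have D: "frechet_derivative (barrier s) (at x) = (\<lambda>z. 2 * s\<^sup>2 * (x \<bullet> z) * (1 / (1 + (norm (s *\<^sub>R x))\<^sup>2))\<^sup>2)"
    by (rule frechet_derivative_at[OF has_derivative_barrier, symmetric])
  show ?thesis
    using inverse_one_plus_norm_expansion(2)[of "s *\<^sub>R x" "s *\<^sub>R z"]
    unfolding D barrier_def scaleR_add_right
    by (simp add: power_mult_distrib power2_eq_square[of s] abs_minus_commute mult.assoc)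
qed

lemma barrier_lipschitz: "\<bar>barrier s (x + z) - barrier s x\<bar> \<le> \<bar>s\<bar> * norm z"
  using inverse_one_plus_norm_expansion(1)[of "s *\<^sub>R x" "s *\<^sub>R z"]
  unfolding barrier_def scaleR_add_right by (simp add: abs_minus_commute)

lemma quadratic_approx_barrier: "quadratic_approx (barrier s)"
  unfolding quadratic_approx_def
proof (intro conjI exI allI)
  show "bounded (range (barrier s))"
    by (auto simp: bounded_iff barrier_nonneg barrier_le_1 intro!: exI[of _ 1])
  show "barrier s differentiable at x" for x using has_derivative_barrier by (auto simp: differentiable_def)
qed (rule barrier_taylor)

text \<open>The increments are bounded both by 1 and by \<open>s * norm z\<close>, hence by
  \<open>(s * norm z) powr (\<alpha> / 2)\<close>. The exponent \<open>\<alpha> / 2\<close> is below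
  1, as this interpolation requires, and below \<alpha>, as convergence of the tail
  requires.\<close>

lemma frac_laplace_kernel_barrier_bound:
  assumes \<alpha>: "0 < \<alpha>" "\<alpha> < 2"
  obtains I J :: real where "\<And>s (x::'a::euclidean_space). 0 < s \<Longrightarrow> \<bar>frac_laplace_kernel \<alpha> 1 (barrier s) x\<bar> \<le> 2 * s\<^sup>2 * I + s powr (\<alpha> / 2) * J"
proof
  let ?I = "LINT z|lborel. indicator {z::'a. norm z < 1} z * ((norm z)\<^sup>2 / norm z powr (real DIM('a) + \<alpha>))"
  let ?J = "LINT z|lborel. indicator {z::'a. 1 \<le> norm z} z * (1 / norm z powr (real DIM('a) + \<alpha> / 2))"
  fix s :: real and x :: 'a
  assume s: "0 < s"
  show "\<bar>frac_laplace_kernel \<alpha> 1 (barrier s) x\<bar> \<le> 2 * s\<^sup>2 * ?I + s powr (\<alpha> / 2) * ?J"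
  proof (rule frac_laplace_kernel_bound[OF \<alpha> quadratic_approx_barrier])
    show "0 < \<alpha> / 2" using \<alpha> by simp
    show "\<bar>barrier s (x + z) - barrier s x - frechet_derivative (barrier s) (at x) z\<bar> \<le> 2 * s\<^sup>2 * (norm z)\<^sup>2" for z
      by (rule barrier_taylor)
    fix z :: 'a
    have "\<bar>barrier s (x + z) - barrier s x\<bar> \<le> (s * norm z) powr (\<alpha> / 2)"
    proof (cases "s * norm z \<le> 1")
      case True
      have "\<bar>barrier s (x + z) - barrier s x\<bar> \<le> (s * norm z) powr 1"
        using barrier_lipschitz[of s x z] s by simp
      also have "\<dots> \<le> (s * norm z) powr (\<alpha> / 2)"
        using True \<alpha> s by (intro powr_mono') auto
      finally show ?thesis .
    next
      case False
      have "\<bar>barrier s (x + z) - barrier s x\<bar> \<le> 1"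
        using barrier_nonneg[of s] barrier_le_1[of s] by (smt (verit))
      also have "\<dots> \<le> (s * norm z) powr (\<alpha> / 2)"
        using False \<alpha> by (intro ge_one_powr_ge_zero) auto
      finally show ?thesis .
    qed
    then show "\<bar>barrier s (x + z) - barrier s x\<bar> \<le> s powr (\<alpha> / 2) * norm z powr (\<alpha> - \<alpha> / 2)"
      using s by (simp add: powr_mult)
  qed
qed

section \<open>Comparison of solutions\<close>

text \<open>The slope of a convex function at \<open>x\<close> is controlled by its values at
  \<open>x - 1\<close> and \<open>x + 1\<close>; hence \<phi> is bounded on the interval enlarged by
  1. The tangent at \<open>x\<close> then gives the one-sided estimate.\<close>

lemma convex_differentiable_lipschitz:
  fixes \<phi> :: "real \<Rightarrow> real"
  assumes conv: "convex_on UNIV \<phi>" and diff: "\<And>x. \<phi> differentiable (at x)"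
  obtains L where "0 \<le> L" "\<And>x y. \<bar>x\<bar> \<le> M \<Longrightarrow> \<bar>y\<bar> \<le> M \<Longrightarrow> \<phi> x - \<phi> y \<le> L * \<bar>x - y\<bar>"
proof -
  have "continuous_on {- M - 1..M + 1} \<phi>"
    using diff by (intro continuous_at_imp_continuous_on ballI differentiable_imp_continuous_within)
  then have "bounded (\<phi> ` {- M - 1..M + 1})"
    by (intro compact_imp_bounded compact_continuous_image) auto
  then obtain C where C: "\<And>x. x \<in> {- M - 1..M + 1} \<Longrightarrow> \<bar>\<phi> x\<bar> \<le> C"
    unfolding bounded_iff by (metis imageI real_norm_def)
  show ?thesis
  proof
    \<comment> \<open>The absolute value keeps the constant nonnegative even when
      \<open>M < -1\<close>, where the interval is empty and \<open>C\<close> is arbitrary.\<close>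
    show "0 \<le> 2 * \<bar>C\<bar>" by simp
    fix x y assume xy: "\<bar>x\<bar> \<le> M" "\<bar>y\<bar> \<le> M"
    have D: "(\<phi> has_real_derivative deriv \<phi> x) (at x)"
      using diff by (simp add: DERIV_deriv_iff_real_differentiable)
    have tangent: "deriv \<phi> x * (z - x) \<le> \<phi> z - \<phi> x" for z
      using D by (intro convex_on_imp_above_tangent[OF conv]) auto
    have "\<bar>deriv \<phi> x\<bar> \<le> 2 * \<bar>C\<bar>"
    proof -
      have "\<bar>\<phi> x\<bar> \<le> C" "\<bar>\<phi> (x + 1)\<bar> \<le> C" "\<bar>\<phi> (x - 1)\<bar> \<le> C"
        using xy by (auto intro!: C)
      then show ?thesis using tangent[of "x + 1"] tangent[of "x - 1"] by simp
    qed
    then have "\<bar>deriv \<phi> x\<bar> * \<bar>x - y\<bar> \<le> 2 * \<bar>C\<bar> * \<bar>x - y\<bar>" by (rule mult_right_mono) simp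
    moreover have "\<phi> x - \<phi> y \<le> deriv \<phi> x * (x - y)" using tangent[of y] by (simp add: algebra_simps)
    moreover have "deriv \<phi> x * (x - y) \<le> \<bar>deriv \<phi> x\<bar> * \<bar>x - y\<bar>" by (metis abs_ge_self abs_mult)
    ultimately show "\<phi> x - \<phi> y \<le> 2 * \<bar>C\<bar> * \<bar>x - y\<bar>" by linarith
  qed
qed

lemma continuous_on_half_line_bounded_above:
  fixes h :: "real \<Rightarrow> real"
  assumes "continuous_on {0..} h"
  obtains H where "\<And>t. 0 \<le> t \<Longrightarrow> t \<le> T \<Longrightarrow> h t \<le> H"
proof -
  have "bounded (h ` {0..T})"
    using assms by (intro compact_imp_bounded compact_continuous_image continuous_on_subset[OF assms]) auto
  then obtain H where "\<And>t. t \<in> {0..T} \<Longrightarrow> \<bar>h t\<bar> \<le> H"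
    unfolding bounded_iff by (metis imageI real_norm_def)
  then show thesis by (intro that[of H]) (auto intro: order_trans[OF abs_ge_self])
qed

text \<open>The kernel is nonnegative at the minimum of the penalized difference. By linearity the
  barrier contribution moves to the other side, and the positive constant preserves the
  inequality.\<close>

lemma frac_laplace_barrier_estimate:
  fixes f g :: "real ^ 'n \<Rightarrow> real"
  assumes \<alpha>: "0 < \<alpha>" "\<alpha> < 2" and fg: "f \<in> Cb2" "g \<in> Cb2" and N: "0 \<le> N"
    and min: "\<And>y. a * (g x - f x) + N * barrier s x \<le> a * (g y - f y) + N * barrier s y"
    and D: "\<bar>frac_laplace_kernel \<alpha> 1 (barrier s) x\<bar> \<le> D"
  shows "- (N * (frac_laplace_const TYPE(real ^ 'n) \<alpha> * D)) \<le> a * (frac_laplace \<alpha> g x - frac_laplace \<alpha> f x)"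
proof -
  let ?c = "frac_laplace_const TYPE(real ^ 'n) \<alpha>"
  have c: "0 < ?c" by (rule frac_laplace_const_pos[OF \<alpha>])
  note q = fg[THEN Cb2_imp_quadratic_approx]
  have qgf: "quadratic_approx (\<lambda>y. a * g y + (- a) * f y)"
    by (rule quadratic_approx_linear_combination[OF q(2,1)])
  \<comment> \<open>The factor 1 gives the sum the exact shape of the linear combination
    lemmas.\<close>
  let ?F = "\<lambda>y. 1 * (a * g y + (- a) * f y) + N * barrier s y"
  have "quadratic_approx ?F"
    by (rule quadratic_approx_linear_combination[OF qgf quadratic_approx_barrier])
  then have "?F differentiable (at x)" by (simp add: quadratic_approx_def)
  moreover have "?F x \<le> ?F y" for y using min[of y] by (simp add: algebra_simps)
  ultimately have "0 \<le> frac_laplace_kernel \<alpha> 1 ?F x"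
    by (rule frac_laplace_kernel_nonneg_at_min[OF \<alpha>])
  also have "\<dots> = a * (frac_laplace_kernel \<alpha> 1 g x - frac_laplace_kernel \<alpha> 1 f x) + N * frac_laplace_kernel \<alpha> 1 (barrier s) x"
    unfolding frac_laplace_kernel_linear_combination[OF \<alpha> qgf quadratic_approx_barrier]
      frac_laplace_kernel_linear_combination[OF \<alpha> q(2,1)] by (simp add: algebra_simps)
  also have "\<dots> \<le> a * (frac_laplace_kernel \<alpha> 1 g x - frac_laplace_kernel \<alpha> 1 f x) + N * D"
    using D N by (intro add_left_mono mult_left_mono) auto
  finally have "0 \<le> ?c * (a * (frac_laplace_kernel \<alpha> 1 g x - frac_laplace_kernel \<alpha> 1 f x) + N * D)"
    using c by simp
  then show ?thesis by (simp add: frac_laplace_def algebra_simps)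
qed

text \<open>If the penalized difference were below the error \<open>- E\<close> at
  \<open>(T, x)\<close>, it would be so at its minimum over times in \<open>{0..T}\<close>. There
  the time derivative is at most 0, while the equation bounds it from below; the two are
  incompatible.\<close>

lemma classical_solution_lower_bound:
  fixes u v :: "real \<Rightarrow> real ^ 'n \<Rightarrow> real"
  assumes \<alpha>: "0 < \<alpha>" "\<alpha> < 2"
    and u: "classical_solution \<alpha> k h \<phi> u0 u" and v: "classical_solution \<alpha> k h \<phi> v0 v"
    and init: "\<And>x. u0 x \<le> v0 x"
    and M: "\<And>t x. 0 \<le> t \<Longrightarrow> \<bar>u t x\<bar> \<le> M" "\<And>t x. 0 \<le> t \<Longrightarrow> \<bar>v t x\<bar> \<le> M"
    and k: "\<And>t. 0 \<le> t \<Longrightarrow> t \<le> T \<Longrightarrow> 0 \<le> k t" "\<And>t. 0 \<le> t \<Longrightarrow> t \<le> T \<Longrightarrow> k t \<le> K"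
    and h: "\<And>t. 0 \<le> t \<Longrightarrow> t \<le> T \<Longrightarrow> 0 \<le> h t" "\<And>t. 0 \<le> t \<Longrightarrow> t \<le> T \<Longrightarrow> h t \<le> H"
    and L: "\<And>x y. \<bar>x\<bar> \<le> M \<Longrightarrow> \<bar>y\<bar> \<le> M \<Longrightarrow> \<phi> x - \<phi> y \<le> L * \<bar>x - y\<bar>" "0 \<le> L"
    and s: "0 < s" and D: "\<And>x::real ^ 'n. \<bar>frac_laplace_kernel \<alpha> 1 (barrier s) x\<bar> \<le> D"
    and T: "0 \<le> T"
  shows "- (K * (4 * M * (frac_laplace_const TYPE(real ^ 'n) \<alpha> * D)))
    \<le> exp (- (H * L + 1) * T) * (v T x - u T x) + 4 * M * barrier s x"
proof (rule ccontr)
  let ?c = "frac_laplace_const TYPE(real ^ 'n) \<alpha>"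
  \<comment> \<open>\<open>H * L\<close> cancels the worst case of the reaction term; the remaining
    1 turns the final inequality into \<open>- E \<le> a * w\<close>.\<close>
  define \<Lambda> where "\<Lambda> = H * L + 1"
  define E where "E = K * (4 * M * (?c * D))"
  define z where "z = (\<lambda>t y. exp (- \<Lambda> * t) * (v t y - u t y) + 4 * M * barrier s y)"
  assume "\<not> ?thesis"
  then have neg: "z T x < - E" by (simp add: z_def E_def \<Lambda>_def)
  have c: "0 < ?c" by (rule frac_laplace_const_pos[OF \<alpha>])
  have M0: "0 \<le> M" using M(1)[of 0 x] by simp
  have D0: "0 \<le> D" using D[of x] by simp
  have K0: "0 \<le> K" using k[OF T] by simp
  have H0: "0 \<le> H" using h[OF T] by simp
  have \<Lambda>0: "0 \<le> \<Lambda>" using H0 L(2) by (simp add: \<Lambda>_def)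
  have Dc0: "0 \<le> 4 * M * (?c * D)" using M0 D0 c by simp
  have E0: "0 \<le> E" using K0 Dc0 unfolding E_def by (rule mult_nonneg_nonneg)
  \<comment> \<open>Here the coefficient \<open>4 * M\<close> is fixed: half of it equals
    \<open>2 * M\<close>, the bound for the difference of the solutions.\<close>
  have far: "0 \<le> z t y" if "0 \<le> t" "1 / s \<le> norm y" for t y
  proof -
    have "exp (- \<Lambda> * t) * \<bar>v t y - u t y\<bar> \<le> 1 * (2 * M)"
      using M[OF \<open>0 \<le> t\<close>, of y] \<Lambda>0 \<open>0 \<le> t\<close> by (intro mult_mono) auto
    then have "- (2 * M) \<le> exp (- \<Lambda> * t) * (v t y - u t y)"
      using mult_left_mono[of "- \<bar>v t y - u t y\<bar>" "v t y - u t y" "exp (- \<Lambda> * t)"] abs_ge_minus_self[of "v t y - u t y"] by simp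
    moreover have "4 * M * (1 / 2) \<le> 4 * M * barrier s y"
      using M0 barrier_ge_half[OF s that(2)] by (intro mult_left_mono) auto
    ultimately show ?thesis by (simp add: z_def)
  qed
  have "continuous_on ({0..T} \<times> cball 0 (1 / s)) (\<lambda>(t, y). z t y)"
  proof -
    have "continuous_on ({0..T} \<times> cball 0 (1 / s)) (\<lambda>p. u (fst p) (snd p))"
      "continuous_on ({0..T} \<times> cball 0 (1 / s)) (\<lambda>p. v (fst p) (snd p))"
      using u v unfolding classical_solution_def case_prod_unfold
      by (auto elim!: continuous_on_subset)
    moreover have "continuous_on UNIV (barrier s :: real ^ 'n \<Rightarrow> real)"
      by (intro continuous_at_imp_continuous_on ballI has_derivative_continuous[OF has_derivative_barrier])
    then have "continuous_on ({0..T} \<times> cball 0 (1 / s)) (\<lambda>p. barrier s (snd p :: real ^ 'n))"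
      by (rule continuous_on_compose2) (auto intro: continuous_intros)
    ultimately show ?thesis
      unfolding z_def case_prod_unfold by (intro continuous_intros)
  qed
  then obtain t0 x0 where t0: "t0 \<in> {0..T}" and x0: "x0 \<in> cball 0 (1 / s)"
    and min: "\<And>t y. t \<in> {0..T} \<Longrightarrow> y \<in> cball 0 (1 / s) \<Longrightarrow> z t0 x0 \<le> z t y"
    using continuous_attains_inf[of "{0..T} \<times> cball 0 (1 / s)" "\<lambda>(t, y). z t y"] T s
    by (force simp: compact_Times)
  have x_in: "x \<in> cball 0 (1 / s)"
    using far[OF T, of x] neg E0 by (force simp: not_le[symmetric])
  then have z0: "z t0 x0 < - E" using min[of T x] neg T by auto
  \<comment> \<open>Compactness gives a minimum over the ball only; nonnegativity outside makes it
    global in space, as the nonlocal operator needs.\<close>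
  have gmin: "z t0 x0 \<le> z t y" if "t \<in> {0..T}" for t y
  proof (cases "norm y \<le> 1 / s")
    case True
    then show ?thesis using min that by simp
  next
    case False
    then show ?thesis using far[of t y] that z0 E0 by simp
  qed
  have "t0 \<noteq> 0"
  proof
    assume "t0 = 0"
    then have "z t0 x0 = v0 x0 - u0 x0 + 4 * M * barrier s x0"
      using u v by (simp add: z_def classical_solution_def)
    then show False using init[of x0] M0 barrier_nonneg[of s x0] z0 E0 by (smt (verit) mult_nonneg_nonneg)
  qed
  then have t0': "0 < t0" "0 \<le> t0" "t0 \<le> T" using t0 by auto
  define a where "a = exp (- \<Lambda> * t0)"
  define w where "w = v t0 x0 - u t0 x0"
  have a: "0 < a" by (simp add: a_def)
  have aw: "a * w < - E"
    using z0 M0 barrier_nonneg[of s x0] unfolding z_def a_def w_def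
    by (smt (verit) mult_nonneg_nonneg)
  then have w: "w < 0" using a E0 by (smt (verit) mult_nonneg_nonneg)
  let ?du = "deriv (\<lambda>t. u t x0) t0" and ?dv = "deriv (\<lambda>t. v t x0) t0"
  have du: "((\<lambda>t. u t x0) has_real_derivative ?du) (at t0)" and dv: "((\<lambda>t. v t x0) has_real_derivative ?dv) (at t0)"
    unfolding DERIV_deriv_iff_real_differentiable using u v t0' by (simp_all add: classical_solution_def)
  have dz: "((\<lambda>t. z t x0) has_real_derivative a * (?dv - ?du) - \<Lambda> * (a * w)) (at t0)"
    unfolding z_def a_def w_def
    by (auto intro!: derivative_eq_intros du dv simp: algebra_simps)
  \<comment> \<open>The minimum may sit at the final time \<open>T\<close>, so it is compared with
    earlier times only; \<open>t0 > 0\<close> leaves room for them.\<close>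
  have "a * (?dv - ?du) - \<Lambda> * (a * w) \<le> 0"
  proof (rule ccontr)
    assume "\<not> ?thesis"
    then obtain d where d: "0 < d" "\<And>r. 0 < r \<Longrightarrow> r < d \<Longrightarrow> z (t0 - r) x0 < z t0 x0"
      using DERIV_pos_inc_left[OF dz] by auto
    have "0 < min (d / 2) t0" "min (d / 2) t0 < d" "t0 - min (d / 2) t0 \<in> {0..T}"
      using d(1) t0' by auto
    then show False using d(2) gmin by (meson not_le)
  qed
  moreover have "- E - H * L * (a * - w) \<le> a * (?dv - ?du)"
  proof -
    have "- (4 * M * (?c * D)) \<le> a * (frac_laplace \<alpha> (v t0) x0 - frac_laplace \<alpha> (u t0) x0)"
    proof (rule frac_laplace_barrier_estimate[OF \<alpha> _ _ _ _ D])
      show "u t0 \<in> Cb2" "v t0 \<in> Cb2" using u v t0' by (simp_all add: classical_solution_def)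
      show "0 \<le> 4 * M" using M0 by simp
      show "a * (v t0 x0 - u t0 x0) + 4 * M * barrier s x0 \<le> a * (v t0 y - u t0 y) + 4 * M * barrier s y" for y
        using gmin[OF t0, of y] by (simp add: z_def a_def)
    qed
    then have "k t0 * - (4 * M * (?c * D)) \<le> k t0 * (a * (frac_laplace \<alpha> (v t0) x0 - frac_laplace \<alpha> (u t0) x0))"
      using k(1) t0' by (intro mult_left_mono) auto
    moreover have "k t0 * (4 * M * (?c * D)) \<le> E"
      unfolding E_def using k(2) t0' Dc0 by (intro mult_right_mono) auto
    moreover have "h t0 * (a * (\<phi> (v t0 x0) - \<phi> (u t0 x0))) \<le> H * (L * (a * - w))"
    proof -
      \<comment> \<open>Because \<open>w < 0\<close>, the distance in the Lipschitz bound is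
        \<open>- w\<close>.\<close>
      have "\<phi> (v t0 x0) - \<phi> (u t0 x0) \<le> L * - w"
        using L(1)[of "v t0 x0" "u t0 x0"] M t0' w by (simp add: w_def)
      then have "a * (\<phi> (v t0 x0) - \<phi> (u t0 x0)) \<le> a * (L * - w)"
        using a by (intro mult_left_mono) auto
      also have "\<dots> = L * (a * - w)" by simp
      finally have "a * (\<phi> (v t0 x0) - \<phi> (u t0 x0)) \<le> L * (a * - w)" .
      then have "h t0 * (a * (\<phi> (v t0 x0) - \<phi> (u t0 x0))) \<le> h t0 * (L * (a * - w))"
        using h(1) t0' by (intro mult_left_mono) auto
      also have "\<dots> \<le> H * (L * (a * - w))"
        using h(2) t0' L(2) a w by (intro mult_right_mono mult_nonneg_nonneg) auto
      finally show ?thesis .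
    qed
    moreover have "?du = k t0 * frac_laplace \<alpha> (u t0) x0 - h t0 * \<phi> (u t0 x0)"
      "?dv = k t0 * frac_laplace \<alpha> (v t0) x0 - h t0 * \<phi> (v t0 x0)"
      using u v t0' by (simp_all add: classical_solution_def)
    then have "a * (?dv - ?du) = k t0 * (a * (frac_laplace \<alpha> (v t0) x0 - frac_laplace \<alpha> (u t0) x0))
        - h t0 * (a * (\<phi> (v t0 x0) - \<phi> (u t0 x0)))"
      by (simp only:) (simp add: algebra_simps)
    ultimately show ?thesis by (simp add: mult.assoc)
  qed
  ultimately have "- E \<le> a * w" by (simp add: \<Lambda>_def algebra_simps)
  with aw show False by simp
qed

lemma classical_solution_bounded:
  assumes "classical_solution \<alpha> k h \<phi> u0 u"
  obtains M where "\<And>t x. 0 \<le> t \<Longrightarrow> \<bar>u t x\<bar> \<le> M"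
proof -
  obtain M where M: "\<forall>y\<in>(\<lambda>(t, x). u t x) ` ({0..} \<times> UNIV). norm y \<le> M"
    using assms by (auto simp only: classical_solution_def bounded_iff)
  have "\<bar>u t x\<bar> \<le> M" if "0 \<le> t" for t x
    using bspec[OF M, of "u t x"] that by force
  then show thesis by (rule that)
qed

text \<open>The constants \<open>M\<close>, \<open>L\<close>, \<open>H\<close>, \<open>K\<close>,
  \<open>I\<close>, \<open>J\<close> are chosen before \<open>s\<close>, so letting \<open>s\<close>
  tend to 0 in the lower bound at a fixed point removes both the error and the barrier.\<close>

lemma classical_solution_mono:
  fixes u v :: "real \<Rightarrow> real ^ 'n \<Rightarrow> real"
  assumes \<alpha>: "0 < \<alpha>" "\<alpha> < 2"
    and \<phi>: "convex_on UNIV \<phi>" "\<And>x. \<phi> differentiable (at x)"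
    and h: "continuous_on {0..} h" "\<And>t. 0 \<le> t \<Longrightarrow> 0 \<le> h t"
    and k: "continuous_on {0..} k" "\<And>t. 0 \<le> t \<Longrightarrow> 0 \<le> k t"
    and u: "classical_solution \<alpha> k h \<phi> u0 u" and v: "classical_solution \<alpha> k h \<phi> v0 v"
    and init: "\<And>x. u0 x \<le> v0 x" and T: "0 \<le> T"
  shows "u T x \<le> v T x"
proof -
  let ?c = "frac_laplace_const TYPE(real ^ 'n) \<alpha>"
  obtain Mu where "\<And>t x. 0 \<le> t \<Longrightarrow> \<bar>u t x\<bar> \<le> Mu"
    using classical_solution_bounded[OF u] by metis
  moreover obtain Mv where "\<And>t x. 0 \<le> t \<Longrightarrow> \<bar>v t x\<bar> \<le> Mv"
    using classical_solution_bounded[OF v] by metis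
  ultimately obtain M where M: "\<And>t x. 0 \<le> t \<Longrightarrow> \<bar>u t x\<bar> \<le> M" "\<And>t x. 0 \<le> t \<Longrightarrow> \<bar>v t x\<bar> \<le> M"
    using that[of "max Mu Mv"] by (meson max.coboundedI1 max.coboundedI2)
  obtain L where L: "0 \<le> L" "\<And>x y. \<bar>x\<bar> \<le> M \<Longrightarrow> \<bar>y\<bar> \<le> M \<Longrightarrow> \<phi> x - \<phi> y \<le> L * \<bar>x - y\<bar>"
    using convex_differentiable_lipschitz[OF \<phi>, of M] by metis
  obtain H where H: "\<And>t. 0 \<le> t \<Longrightarrow> t \<le> T \<Longrightarrow> h t \<le> H" using continuous_on_half_line_bounded_above[OF h(1)] by metis
  obtain K where K: "\<And>t. 0 \<le> t \<Longrightarrow> t \<le> T \<Longrightarrow> k t \<le> K" using continuous_on_half_line_bounded_above[OF k(1)] by metis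
  obtain I J where IJ: "\<And>s (x::real ^ 'n). 0 < s \<Longrightarrow>
      \<bar>frac_laplace_kernel \<alpha> 1 (barrier s) x\<bar> \<le> 2 * s\<^sup>2 * I + s powr (\<alpha> / 2) * J"
    using frac_laplace_kernel_barrier_bound[OF \<alpha>, where 'a="real ^ 'n"] by metis
  let ?W = "exp (- (H * L + 1) * T) * (v T x - u T x)"
  \<comment> \<open>All dependence on \<open>s\<close>, including the barrier at \<open>x\<close>,
    is collected here, so that \<open>?W\<close> stays fixed in the limit.\<close>
  let ?b = "\<lambda>s. - (K * (4 * M * (?c * (2 * s\<^sup>2 * I + s powr (\<alpha> / 2) * J)))) - 4 * M * barrier s x"
  have "?b s \<le> ?W" if "0 < s" for s
    using classical_solution_lower_bound[OF \<alpha> u v init M k(2) K h(2) H L(2,1) that IJ[OF that] T, of x] by linarith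
  then have "\<forall>\<^sub>F s in at_right 0. ?b s \<le> ?W" by (rule eventually_mono[OF eventually_at_right_less])
  \<comment> \<open>The limit is 0; it is written in the shape of \<open>?b\<close> so that the
    limit rules apply termwise.\<close>
  moreover have "(?b \<longlongrightarrow> - (K * (4 * M * (?c * (2 * 0\<^sup>2 * I + 0 * J)))) - 4 * M * 0) (at_right 0)"
  proof (intro tendsto_intros)
    show "((\<lambda>s. s powr (\<alpha> / 2)) \<longlongrightarrow> 0) (at_right (0::real))"
      by (rule tendsto_zero_powrI[where b="\<alpha> / 2"]) (use \<alpha> in \<open>auto intro: tendsto_intros eventually_mono[OF eventually_at_right_less]\<close>)
    have "isCont (\<lambda>s. barrier s x) 0"
      unfolding barrier_def by (intro continuous_intros) simp
    then show "((\<lambda>s. barrier s x) \<longlongrightarrow> 0) (at_right 0)"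
      by (simp add: isCont_def barrier_def filterlim_at_split)
  qed
  ultimately have "- (K * (4 * M * (?c * (2 * 0\<^sup>2 * I + 0 * J)))) - 4 * M * 0 \<le> ?W"
    by (intro tendsto_upperbound) auto
  then show ?thesis by (simp add: zero_le_mult_iff)
qed

lemma classical_solution_zero:
  assumes "\<phi> 0 = 0"
  shows "classical_solution \<alpha> k h \<phi> (\<lambda>x::'a::euclidean_space. 0) (\<lambda>t x. 0)"
proof -
  have "(\<lambda>x::'a. 0::real) \<in> Cb2"
    unfolding Cb2_def
    by (auto intro!: exI[of _ "\<lambda>x. 0"] simp: bounded_iff zero_blinfun.rep_eq)
  moreover have "frac_laplace \<alpha> (\<lambda>x::'a. 0) = (\<lambda>x. 0)"
    by (simp add: frac_laplace_def frac_laplace_kernel_def fun_eq_iff frechet_derivative_const)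
  ultimately show ?thesis
    using assms by (auto simp: classical_solution_def bounded_iff case_prod_unfold)
qed

theorem theorem7:
  fixes \<alpha> :: real
    and \<phi> h k :: "real \<Rightarrow> real"
    and u0 v0 :: "real ^ 'n \<Rightarrow> real"
    and u v :: "real \<Rightarrow> real ^ 'n \<Rightarrow> real"
  assumes "0 < \<alpha>" and "\<alpha> < 2"
    and "\<And>x. 0 \<le> \<phi> x" and "convex_on UNIV \<phi>" and "\<And>x. \<phi> differentiable (at x)"
    and "\<phi> 0 = 0" and "\<And>x. x \<noteq> 0 \<Longrightarrow> 0 < \<phi> x"
    and "continuous_on {0..} h" and "\<And>t. 0 \<le> t \<Longrightarrow> 0 \<le> h t" and "\<And>t. 0 < t \<Longrightarrow> 0 < h t"
    and "continuous_on {0..} k" and "\<And>t. 0 \<le> t \<Longrightarrow> 0 \<le> k t"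
    \<comment> \<open>In \<open>ennreal\<close> the inverse of \<open>0\<close> is \<open>\<infinity>\<close>, so the integrand is the \<open>-1/\<alpha>\<close>-th power with
      values in \<open>[0, \<infinity>]\<close>; the real-valued \<open>0 powr (-1/\<alpha>)\<close> would be \<open>0\<close>.\<close>
    and "\<And>T. 0 < T \<Longrightarrow>
           (SUP t\<in>{0..T}. \<integral>\<^sup>+s\<in>{0..t}. inverse (ennreal (integral {s..t} k powr (1 / \<alpha>))) \<partial>lborel) < \<infinity>"
    and "u0 \<in> bcontfun" and "integrable lborel u0"
    and "v0 \<in> bcontfun" and "integrable lborel v0"
    and "classical_solution \<alpha> k h \<phi> u0 u"
    and "classical_solution \<alpha> k h \<phi> v0 v"
    and "\<And>x. 0 \<le> u0 x" and "\<And>x. u0 x \<le> v0 x"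
  shows "\<forall>t\<ge>0. \<forall>x. 0 \<le> u t x \<and> u t x \<le> v t x"
proof (intro allI impI conjI)
  fix t :: real and x :: "real ^ 'n"
  assume t: "0 \<le> t"
  show "0 \<le> u t x"
    by (rule classical_solution_mono[OF assms(1,2,4,5,8) _ assms(11) _
          classical_solution_zero[where \<phi>=\<phi>, OF assms(6)] assms(18,20) t]) (use assms(9,12) in auto)
  show "u t x \<le> v t x"
    by (rule classical_solution_mono[OF assms(1,2,4,5,8) _ assms(11) _ assms(18,19,21) t])
      (use assms(9,12) in auto)
qed

end
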